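(* Let $X$ be a metrizable compact space with $\dim X\leq n$, and let $m\geq 2n+1$. Then the set of all maps $g\in C(X,\mathbb R^m)$ such that $\dim P_{2,1,m}(g,z)\leq 0$ for every $z\in\mathbb R^m\setminus g(X)$ is a dense $G_\delta$-subset of $C(X,\mathbb R^m)$.
   Context: All spaces are metrizable and all single-valued maps are continuous; $\dim$ is covering dimension. For compact $X$, $C(X,\mathbb R^m)$ is the space of all continuous maps $X\to\mathbb R^m$ with the topology of uniform convergence. $M_{m,d}$ denotes the space of all $d$-dimensional (affine) planes $\Pi^d$ in $\mathbb R^m$, with its standard metrizable topology. For a map $g$ from a space $X$ into $\mathbb R^m$, an integer $q$ and a point $z\notin g(X)$, put $$P_{q,d,m}(g,z)=\{\Pi^d\in M_{m,d}: |g^{-1}(\Pi^d)|\geq q\ \text{and}\ z\in\Pi^d\},$$ considered as a subspace of $M_{m,d}$. In particular, $P_{2,1,m}(g,z)$ is the set of all lines in $\mathbb R^m$ containing $z$ whose preimage under $g$ has at least two points. *)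

theory Defs
  imports "HOL-Analysis.Analysis"
begin

text \<open>
  \<^verbatim>\<open>covering_dim_le X n\<close> says that the covering dimension of \<open>X\<close> is at most \<open>n\<close>:
  every finite open cover has a finite open refinement of order at most \<open>n\<close>, i.e. one in
  which every point lies in at most \<open>n + 1\<close> members.  The library's \<open>dim_le\<close> is the small
  inductive dimension, which is a different notion.
\<close>

definition open_cover_of :: "'a topology \<Rightarrow> 'a set set \<Rightarrow> bool" where
  "open_cover_of X \<U> \<longleftrightarrow> (\<forall>U\<in>\<U>. openin X U) \<and> \<Union>\<U> = topspace X"

definition refines :: "'a set set \<Rightarrow> 'a set set \<Rightarrow> bool" where
  "refines \<V> \<U> \<longleftrightarrow> (\<forall>V\<in>\<V>. \<exists>U\<in>\<U>. V \<subseteq> U)"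

definition covering_dim_le :: "'a topology \<Rightarrow> nat \<Rightarrow> bool" where
  "covering_dim_le X n \<longleftrightarrow>
     (\<forall>\<U>. finite \<U> \<and> open_cover_of X \<U> \<longrightarrow>
        (\<exists>\<V>. finite \<V> \<and> open_cover_of X \<V> \<and> refines \<V> \<U> \<and>
             (\<forall>x\<in>topspace X. card {V \<in> \<V>. x \<in> V} \<le> n + 1)))"

definition planes :: "nat \<Rightarrow> 'b::euclidean_space set set" where
  "planes d = {S. affine S \<and> aff_dim S = int d}"

text \<open>
  The standard topology on the set of \<open>d\<close>-planes: the quotient of the space of affinely
  independent \<open>(d+1)\<close>-tuples of points under the map sending a tuple to its affine hull.
\<close>

definition aff_frames :: "nat \<Rightarrow> (nat \<Rightarrow> 'b::euclidean_space) topology" where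
  "aff_frames d =
     subtopology (product_topology (\<lambda>_. euclidean) {..d})
       {p. inj_on p {..d} \<and> \<not> affine_dependent (p ` {..d})}"

definition plane_span :: "nat \<Rightarrow> (nat \<Rightarrow> 'b::euclidean_space) \<Rightarrow> 'b set" where
  "plane_span d p = affine hull (p ` {..d})"

definition plane_space :: "nat \<Rightarrow> 'b::euclidean_space set topology" where
  "plane_space d = topology (\<lambda>\<W>. \<W> \<subseteq> planes d \<and>
     openin (aff_frames d) {p \<in> topspace (aff_frames d). plane_span d p \<in> \<W>})"

lemma openin_plane_space:
  fixes \<W> :: "'b::euclidean_space set set"
  shows "openin (plane_space d) \<W> \<longleftrightarrow> \<W> \<subseteq> planes d \<and>
     openin (aff_frames d) {p \<in> topspace (aff_frames d). plane_span d p \<in> \<W>}"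
proof -
  let ?L = "\<lambda>\<W> :: 'b set set. \<W> \<subseteq> planes d \<and>
     openin (aff_frames d) {p \<in> topspace (aff_frames d). plane_span d p \<in> \<W>}"
  have "istopology ?L"
    unfolding istopology_def
  proof (intro conjI allI impI)
    fix S T :: "'b set set" assume S: "?L S" and T: "?L T"
    show "S \<inter> T \<subseteq> planes d" using S by blast
    have "{p \<in> topspace (aff_frames d). plane_span d p \<in> S \<inter> T} =
        {p \<in> topspace (aff_frames d). plane_span d p \<in> S} \<inter>
        {p \<in> topspace (aff_frames d). plane_span d p \<in> T}" by blast
    then show "openin (aff_frames d) {p \<in> topspace (aff_frames d). plane_span d p \<in> S \<inter> T}"
      using S T by (simp add: openin_Int)
  next
    fix \<K> :: "'b set set set" assume K: "\<forall>K\<in>\<K>. ?L K"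
    then show "\<Union>\<K> \<subseteq> planes d" by blast
    have "{p \<in> topspace (aff_frames d). plane_span d p \<in> \<Union>\<K>} =
        (\<Union>K\<in>\<K>. {p \<in> topspace (aff_frames d). plane_span d p \<in> K})" by blast
    then show "openin (aff_frames d) {p \<in> topspace (aff_frames d). plane_span d p \<in> \<Union>\<K>}"
      using K by auto
  qed
  then show ?thesis
    by (simp add: plane_space_def topology_inverse')
qed

lemma plane_span_in_planes:
  fixes p :: "nat \<Rightarrow> 'b::euclidean_space"
  assumes "p \<in> topspace (aff_frames d)"
  shows "plane_span d p \<in> planes d"
proof -
  have p: "inj_on p {..d}" "\<not> affine_dependent (p ` {..d})"
    using assms by (auto simp: aff_frames_def)
  have "aff_dim (p ` {..d}) = int (card (p ` {..d})) - 1"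
    using aff_independent_finite[OF p(2)] aff_dim_affine_independent[OF p(2)] by simp
  then show ?thesis
    using card_image[OF p(1)] by (simp add: plane_span_def planes_def affine_affine_hull)
qed

lemma topspace_plane_space [simp]:
  "topspace (plane_space d) = (planes d :: 'b::euclidean_space set set)"
proof -
  have eq: "{p \<in> topspace (aff_frames d). plane_span d p \<in> (planes d :: 'b set set)}
      = topspace (aff_frames d)"
    using plane_span_in_planes by auto
  have "openin (plane_space d) (planes d :: 'b set set)"
    unfolding openin_plane_space eq by simp
  moreover have "topspace (plane_space d) \<subseteq> (planes d :: 'b set set)"
    using openin_topspace[of "plane_space d"] unfolding openin_plane_space by (rule conjunct1)
  ultimately show ?thesis
    by (simp add: openin_subset subset_antisym)
qed

lemma quotient_map_plane_span:
  "quotient_map (aff_frames d) (plane_space d)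
     (plane_span d :: (nat \<Rightarrow> 'b::euclidean_space) \<Rightarrow> 'b set)"
proof -
  have "S \<in> plane_span d ` topspace (aff_frames d)" if S: "S \<in> planes d" for S :: "'b set"
  proof -
    obtain B where B: "\<not> affine_dependent B" "affine hull B = S"
      using affine_basis_exists[of S] S by (auto simp: planes_def hull_same)
    have fin: "finite B"
      using B(1) aff_independent_finite by blast
    have "aff_dim S = int (card B) - 1"
      using aff_dim_affine_independent[OF B(1)] aff_dim_affine_hull[of B] B(2) by simp
    then have "card B = card {..d}"
      using S by (simp add: planes_def)
    then obtain p where p: "bij_betw p {..d} B"
      using finite_same_card_bij[OF finite_atMost[of d] fin] by auto
    define r where "r = restrict p {..d}"
    have r: "r ` {..d} = B" "inj_on r {..d}" "r \<in> extensional {..d}"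
      using p by (auto simp: r_def bij_betw_def inj_on_def)
    then show ?thesis
      using B by (intro image_eqI[of _ _ r]) (auto simp: plane_span_def aff_frames_def PiE_def)
  qed
  then have "plane_span d ` topspace (aff_frames d) = (planes d :: 'b set set)"
    using plane_span_in_planes by blast
  then show ?thesis
    by (auto simp: quotient_map_def openin_plane_space)
qed

text \<open>
  The preimage may be infinite, where \<open>card\<close> is \<open>0\<close>; hence "at least \<open>q\<close> points" is expressed
  by the existence of a finite subset with exactly \<open>q\<close> elements.
\<close>

definition plane_preimages ::
    "'a topology \<Rightarrow> nat \<Rightarrow> nat \<Rightarrow> ('a \<Rightarrow> 'b::euclidean_space) \<Rightarrow> 'b \<Rightarrow> 'b set set" where
  "plane_preimages X q d g z =
     {L \<in> planes d. (\<exists>F. F \<subseteq> {x \<in> topspace X. g x \<in> L} \<and> finite F \<and> card F = q) \<and> z \<in> L}"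

text \<open>
  \<open>C(X, \<real>\<^sup>m)\<close> as the library's metric space \<open>cfunspace\<close> with the supremum metric.  Its elements
  are bounded continuous maps, which for compact \<open>X\<close> are all the continuous maps, and they are
  \<open>extensional\<close>, so that maps agreeing on \<open>X\<close> are equal.
\<close>

abbreviation map_space :: "'a topology \<Rightarrow> ('a \<Rightarrow> 'b::euclidean_space) metric" where
  "map_space X \<equiv> cfunspace X euclidean_metric"

lemma mspace_map_space_compact:
  assumes "compact_space X"
  shows "mspace (map_space X) =
    {f. f \<in> extensional (topspace X) \<and> continuous_map X euclidean f}"
proof -
  have "bounded (f ` topspace X)" if "continuous_map X euclidean f" for f :: "'a \<Rightarrow> 'b"
  proof -
    have "compactin euclidean (f ` topspace X)"
      using assms that unfolding compact_space_def by (rule image_compactin)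
    then show ?thesis
      by (simp add: compact_imp_bounded)
  qed
  then show ?thesis
    by auto
qed

end

theory Submission
  imports Defs
begin

text \<open>
  A line through \<open>z \<notin> g(X)\<close> is determined by its direction, so the set of lines through \<open>z\<close> with at
  least two preimages is homeomorphic to a subset \<open>D\<close> of the projective space of directions, and \<open>D\<close> is
  the increasing union of the compact sets \<open>D\<^sub>r\<close> of directions of lines that contain \<open>g x\<close> and
  \<open>g y\<close> for some \<open>x, y\<close> with \<open>d(x, y) \<ge> r\<close>.  By the countable sum theorem, \<open>D\<close> is zero-dimensional
  iff every \<open>D\<^sub>r\<close> is covered, for every \<open>\<epsilon> > 0\<close>, by finitely many disjoint open sets of diameter less
  than \<open>\<epsilon>\<close>.  For fixed \<open>r = \<epsilon>\<close>, and \<open>z\<close> ranging over a compact set at distance at least \<open>r\<close> from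
  \<open>g(X)\<close>, compactness makes this condition stable under small perturbations of \<open>g\<close>; hence the set in
  question is \<open>G\<^sub>\<delta>\<close>.

  For density, approximate \<open>g\<close> by the composition of the canonical map to the nerve of a fine cover
  of order at most \<open>n\<close> with a map of the nerve that is affine on simplices and sends the vertices to
  points in general position.  If \<open>d(x, y) \<ge> r\<close> then \<open>x\<close> and \<open>y\<close> are carried by disjoint simplices,
  with at most \<open>2 n + 2 \<le> m + 1\<close> vertices altogether.  These vertices are affinely independent, so at
  most one line through \<open>z\<close> meets both simplices: \<open>D\<^sub>r\<close> is finite.  The Baire category theorem
  concludes.
\<close>

subsection \<open>Zero-dimensional sets as countable unions of compact sets\<close>

text \<open>Closed \<open>e\<close>-neighbourhoods of the \<open>A i\<close> serve as the
  \<open>B i\<close>: each inclusion and each pairwise disjointness holds for all small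
  \<open>e > 0\<close>, and since there are only finitely many of these conditions, one
  \<open>e\<close> satisfies them all.\<close>

lemma disjoint_compact_family_neighbourhoods:
  fixes A U :: "'i \<Rightarrow> 'a::euclidean_space set"
  assumes I: "finite I"
    and A: "\<And>i. i \<in> I \<Longrightarrow> compact (A i)" "\<And>i. i \<in> I \<Longrightarrow> A i \<subseteq> U i"
    and U: "\<And>i. i \<in> I \<Longrightarrow> open (U i)"
    and disj: "disjoint_family_on A I"
  obtains B where "\<And>i. i \<in> I \<Longrightarrow> compact (B i)" "\<And>i. i \<in> I \<Longrightarrow> A i \<subseteq> interior (B i)"
    "\<And>i. i \<in> I \<Longrightarrow> B i \<subseteq> U i" "disjoint_family_on B I"
proof -
  define N where "N \<equiv> \<lambda>i e. \<Union>x\<in>A i. cball x e"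
  have mono: "N i e \<subseteq> N i e'" if "e \<le> e'" for i e e'
    unfolding N_def using that by (intro UN_mono subset_cball) auto
  have 1: "\<forall>\<^sub>F e in at_right 0. N i e \<subseteq> U i" if i: "i \<in> I" for i
  proof -
    obtain d where d: "d > 0" "N i d \<subseteq> U i"
      unfolding N_def
      by (rule compact_subset_open_imp_cball_epsilon_subset[OF A(1)[OF i] U[OF i] A(2)[OF i]])
    have "N i e \<subseteq> U i" if "e < d" for e
      by (rule order_trans[OF mono d(2)]) (use that in simp)
    then show ?thesis
      unfolding eventually_at_right_field using d(1) by (intro exI[of _ d]) auto
  qed
  have 2: "\<forall>\<^sub>F e in at_right 0. N i e \<inter> N j e = {}" if ij: "i \<in> I" "j \<in> I" "i \<noteq> j" for i j
  proof -
    have "A i \<inter> A j = {}"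
      using disj that by (auto simp: disjoint_family_on_def)
    then obtain d where d: "d > 0" "\<And>x y. x \<in> A i \<Longrightarrow> y \<in> A j \<Longrightarrow> d \<le> dist x y"
      using separate_compact_closed[of "A i" "A j"] A(1)[OF ij(1)] compact_imp_closed[OF A(1)[OF ij(2)]]
      by blast
    have "N i e \<inter> N j e = {}" if "e < d/2" for e
    proof (rule ccontr)
      assume "N i e \<inter> N j e \<noteq> {}"
      then obtain x y z where "x \<in> A i" "y \<in> A j" "dist x z \<le> e" "dist y z \<le> e"
        by (auto simp: N_def)
      then show False
        using d(2)[of x y] that dist_triangle2[of x y z] by linarith
    qed
    then show ?thesis
      unfolding eventually_at_right_field using d(1)
      by (intro exI[of _ "d/2"]) auto
  qed
  have "\<forall>\<^sub>F e in at_right 0. (\<forall>i\<in>I. N i e \<subseteq> U i) \<and> (\<forall>i\<in>I. \<forall>j\<in>I. i \<noteq> j \<longrightarrow> N i e \<inter> N j e = {})"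
  proof (intro eventually_conj eventually_ball_finite[OF I] ballI)
    show "\<forall>\<^sub>F e in at_right 0. i \<noteq> j \<longrightarrow> N i e \<inter> N j e = {}" if "i \<in> I" "j \<in> I" for i j
      using 2[OF that] by (cases "i = j") auto
  qed (rule 1)
  then have "\<exists>e>0. (\<forall>i\<in>I. N i e \<subseteq> U i) \<and> (\<forall>i\<in>I. \<forall>j\<in>I. i \<noteq> j \<longrightarrow> N i e \<inter> N j e = {})"
    unfolding eventually_at_right_field by (meson dense)
  then obtain e where e: "e > 0" "\<forall>i\<in>I. N i e \<subseteq> U i"
    "\<forall>i\<in>I. \<forall>j\<in>I. i \<noteq> j \<longrightarrow> N i e \<inter> N j e = {}"
    by (elim exE conjE)
  show thesis
  proof (rule that[of "\<lambda>i. N i e"])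
    show "A i \<subseteq> interior (N i e)" if "i \<in> I" for i
    proof -
      have "ball x e \<subseteq> interior (N i e)" if "x \<in> A i" for x
        using that by (intro interior_maximal) (auto simp: N_def)
      then show ?thesis
        using e(1) by force
    qed
  qed (use e A in \<open>auto simp: N_def compact_minkowski_sum_cball disjoint_family_on_def\<close>)
qed

text \<open>The members of \<open>\<V>\<close> are open and disjoint in the ambient space, not
  merely relative to \<open>K\<close>. The same family therefore still works for sets close to a
  compact \<open>K\<close>, which is what makes the condition stable when \<open>g\<close> and
  \<open>z\<close> move.\<close>

definition fine_separated :: "real \<Rightarrow> 'a::metric_space set \<Rightarrow> bool" where
  "fine_separated \<epsilon> K \<longleftrightarrow> (\<exists>\<V>. finite \<V> \<and> disjoint \<V> \<and> K \<subseteq> \<Union>\<V> \<and>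
     (\<forall>V\<in>\<V>. open V \<and> (\<forall>a\<in>V. \<forall>b\<in>V. dist a b < \<epsilon>)))"

text \<open>Disjoint compact pieces thicken to disjoint neighbourhoods inside the given balls; these
  are open of radius \<open>\<epsilon>/2\<close>, which gives the strict bound on distances.\<close>

lemma fine_separatedI_family:
  fixes A :: "'i \<Rightarrow> 'a::euclidean_space set"
  assumes "finite I" and A: "\<And>i. i \<in> I \<Longrightarrow> compact (A i)" "disjoint_family_on A I"
    and c: "\<And>i. i \<in> I \<Longrightarrow> A i \<subseteq> ball (c i) (\<epsilon>/2)" and K: "K \<subseteq> (\<Union>i\<in>I. A i)"
  shows "fine_separated \<epsilon> K"
proof -
  obtain B where B: "\<And>i. i \<in> I \<Longrightarrow> A i \<subseteq> interior (B i)"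
    "\<And>i. i \<in> I \<Longrightarrow> B i \<subseteq> ball (c i) (\<epsilon>/2)" "disjoint_family_on B I"
    using disjoint_compact_family_neighbourhoods[of I A "\<lambda>i. ball (c i) (\<epsilon>/2)"] assms
    by (metis open_ball)
  have "dist a b < \<epsilon>" if "i \<in> I" "a \<in> interior (B i)" "b \<in> interior (B i)" for i a b
  proof -
    have "a \<in> ball (c i) (\<epsilon>/2)" "b \<in> ball (c i) (\<epsilon>/2)"
      using that B(2) interior_subset by blast+
    then show ?thesis
      using dist_triangle_half_l[of a "c i" \<epsilon> b] by (simp add: dist_commute)
  qed
  moreover have "disjoint_family_on (\<lambda>i. interior (B i)) I"
    using B(3) interior_subset unfolding disjoint_family_on_def by blast
  then have "disjoint ((\<lambda>i. interior (B i)) ` I)"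
    by (rule disjoint_family_on_disjoint_image)
  moreover have "K \<subseteq> \<Union>((\<lambda>i. interior (B i)) ` I)"
    using K B(1) by blast
  ultimately show ?thesis
    unfolding fine_separated_def using \<open>finite I\<close>
    by (intro exI[of _ "(\<lambda>i. interior (B i)) ` I"]) auto
qed

lemma fine_separated_finite:
  fixes K :: "'a::euclidean_space set"
  assumes "finite K" "\<epsilon> > 0"
  shows "fine_separated \<epsilon> K"
  using assms
  by (intro fine_separatedI_family[of K "\<lambda>x. {x}" "\<lambda>x. x"]) (auto simp: disjoint_family_on_def)

lemma fine_separated_subset:
  assumes "fine_separated \<epsilon> K" "L \<subseteq> K" "\<epsilon> \<le> \<epsilon>'"
  shows "fine_separated \<epsilon>' L"
proof -
  obtain \<V> where \<V>: "finite \<V>" "disjoint \<V>" "K \<subseteq> \<Union>\<V>" "\<And>V. V \<in> \<V> \<Longrightarrow> open V"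
    "\<And>V a b. V \<in> \<V> \<Longrightarrow> a \<in> V \<Longrightarrow> b \<in> V \<Longrightarrow> dist a b < \<epsilon>"
    using assms(1) unfolding fine_separated_def by blast
  show ?thesis
    unfolding fine_separated_def
  proof (intro exI[of _ \<V>] conjI ballI)
    show "dist a b < \<epsilon>'" if "V \<in> \<V>" "a \<in> V" "b \<in> V" for V a b
      using \<V>(5)[OF that] assms(3) by simp
  qed (use \<V> assms(2) in auto)
qed

section \<open>Covering dimension zero and the countable sum theorem\<close>

lemma card_le_1_iff_disjoint_cover:
  assumes "finite \<V>"
  shows "(\<forall>x. card {V \<in> \<V>. x \<in> V} \<le> Suc 0) \<longleftrightarrow> disjoint \<V>"
proof -
  have "card {V \<in> \<V>. x \<in> V} \<le> Suc 0 \<longleftrightarrow> (\<forall>V\<in>\<V>. \<forall>W\<in>\<V>. x \<in> V \<longrightarrow> x \<in> W \<longrightarrow> V = W)" for x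
    using assms by (subst card_le_Suc0_iff_eq) auto
  then show ?thesis
    by (auto simp: disjoint_def)
qed

lemma covering_dim_le_0_iff:
  "covering_dim_le X 0 \<longleftrightarrow>
     (\<forall>\<U>. finite \<U> \<and> open_cover_of X \<U> \<longrightarrow>
        (\<exists>\<V>. finite \<V> \<and> open_cover_of X \<V> \<and> refines \<V> \<U> \<and> disjoint \<V>))"
proof -
  have "(\<forall>x\<in>topspace X. card {V \<in> \<V>. x \<in> V} \<le> 0 + 1) \<longleftrightarrow> disjoint \<V>"
    if "finite \<V>" "open_cover_of X \<V>" for \<V>
  proof -
    \<comment> \<open>Points outside the space lie in no member, so the bound may be demanded of all
      points.\<close>
    have "{V \<in> \<V>. x \<in> V} = {}" if "x \<notin> topspace X" for x
      using that \<open>open_cover_of X \<V>\<close> by (auto simp: open_cover_of_def)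
    then have "(\<forall>x\<in>topspace X. card {V \<in> \<V>. x \<in> V} \<le> Suc 0) \<longleftrightarrow> (\<forall>x. card {V \<in> \<V>. x \<in> V} \<le> Suc 0)"
      by (metis card.empty le0)
    then show ?thesis
      using card_le_1_iff_disjoint_cover[OF that(1)] by simp
  qed
  then show ?thesis
    unfolding covering_dim_le_def by meson
qed

text \<open>The other members of \<open>\<V>\<close> have a relatively open union, and removing it
  from \<open>K\<close> leaves exactly \<open>K \<inter> V\<close>, which is therefore closed in
  \<open>K\<close>.\<close>

lemma compact_Int_disjoint_open:
  fixes K :: "'a::t2_space set"
  assumes "compact K" "K \<subseteq> S" "\<And>V. V \<in> \<V> \<Longrightarrow> openin (top_of_set S) V" "disjoint \<V>" "K \<subseteq> \<Union>\<V>" "V \<in> \<V>"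
  shows "compact (K \<inter> V)"
proof -
  have "openin (top_of_set S) (\<Union>(\<V> - {V}))"
    using assms by blast
  then obtain W where W: "open W" "\<Union>(\<V> - {V}) = S \<inter> W"
    by (auto simp: openin_open)
  have "V \<inter> \<Union>(\<V> - {V}) = {}"
    using assms(4,6) by (auto simp: disjoint_def)
  moreover have "x \<in> V" if x: "x \<in> K" "x \<notin> W" for x
  proof -
    obtain V' where "V' \<in> \<V>" "x \<in> V'"
      using assms(5) x(1) by blast
    then show ?thesis
      using W(2) x(2) by (cases "V' = V") auto
  qed
  ultimately have "K \<inter> V = K - W"
    using W(2) assms(2) by auto
  then show ?thesis
    using W assms(1) by (simp add: compact_diff)
qed

text \<open>A disjoint refinement of a cover by small balls cuts \<open>K\<close> into finitely many
  small compact pieces, which can then be thickened.\<close>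

lemma covering_dim_le_0_imp_fine_separated:
  fixes D :: "'a::euclidean_space set"
  assumes D: "covering_dim_le (top_of_set D) 0" and K: "compact K" "K \<subseteq> D" and "\<epsilon> > 0"
  shows "fine_separated \<epsilon> K"
proof -
  obtain F where F: "finite F" "F \<subseteq> K" "K \<subseteq> (\<Union>x\<in>F. ball x (\<epsilon>/2))"
    using compactE_image[OF K(1), of K "\<lambda>x. ball x (\<epsilon>/2)"] \<open>\<epsilon> > 0\<close>
    by (metis (no_types, lifting) UN_I centre_in_ball half_gt_zero open_ball subsetI)
  \<comment> \<open>\<open>D - K\<close> completes the balls to a cover of \<open>D\<close>. A
    member of the refinement that lies in \<open>D - K\<close> has empty trace on \<open>K\<close>,
    so any centre will do for it.\<close>
  define \<U> where "\<U> = insert (D - K) ((\<lambda>x. D \<inter> ball x (\<epsilon>/2)) ` F)"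
  have "openin (top_of_set D) (D - K)"
    using K by (metis Diff_eq compact_imp_closed open_Compl openin_open_Int)
  then have "finite \<U>" "open_cover_of (top_of_set D) \<U>"
    using F by (auto simp: \<U>_def open_cover_of_def)
  then obtain \<V> where \<V>: "finite \<V>" "open_cover_of (top_of_set D) \<V>" "refines \<V> \<U>" "disjoint \<V>"
    using D unfolding covering_dim_le_0_iff by meson
  have sub: "K \<subseteq> \<Union>\<V>"
    using \<V>(2) K(2) by (auto simp: open_cover_of_def)
  have "\<exists>x. K \<inter> V \<subseteq> ball x (\<epsilon>/2)" if "V \<in> \<V>" for V
  proof -
    obtain U where "U \<in> \<U>" "V \<subseteq> U"
      using \<V>(3) \<open>V \<in> \<V>\<close> by (auto simp: refines_def)
    then show ?thesis
      by (auto simp: \<U>_def)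
  qed
  then obtain c where c: "\<And>V. V \<in> \<V> \<Longrightarrow> K \<inter> V \<subseteq> ball (c V) (\<epsilon>/2)"
    by metis
  show ?thesis
  proof (rule fine_separatedI_family[OF \<V>(1), of "\<lambda>V. K \<inter> V" c])
    show "compact (K \<inter> V)" if "V \<in> \<V>" for V
      using compact_Int_disjoint_open[OF K _ \<V>(4) sub that] \<V>(2)
      by (simp add: open_cover_of_def)
    show "disjoint_family_on (\<lambda>V. K \<inter> V) \<V>"
      using \<V>(4) by (auto simp: disjoint_family_on_def disjoint_def)
  qed (use c sub in auto)
qed

text \<open>Inductive step of the countable sum theorem: the disjoint sets chosen so far are
  enlarged, each within its own \<open>U i\<close>, until their interiors also cover
  \<open>K\<close>.\<close>

lemma fine_separated_extend:
  fixes A U :: "'i \<Rightarrow> 'a::euclidean_space set"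
  assumes I: "finite I"
    and A: "\<And>i. i \<in> I \<Longrightarrow> compact (A i)" "\<And>i. i \<in> I \<Longrightarrow> A i \<subseteq> U i" "disjoint_family_on A I"
    and U: "\<And>i. i \<in> I \<Longrightarrow> open (U i)"
    and K: "compact K" "K \<subseteq> (\<Union>i\<in>I. U i)" "\<And>\<epsilon>. \<epsilon> > 0 \<Longrightarrow> fine_separated \<epsilon> K"
  obtains B where "\<And>i. i \<in> I \<Longrightarrow> compact (B i)" "\<And>i. i \<in> I \<Longrightarrow> A i \<subseteq> interior (B i)"
    "\<And>i. i \<in> I \<Longrightarrow> B i \<subseteq> U i" "disjoint_family_on B I" "K \<subseteq> (\<Union>i\<in>I. interior (B i))"
proof -
  \<comment> \<open>Removing the other \<open>A j\<close> ensures that a piece of \<open>K\<close>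
    inside \<open>G i\<close> can be added to \<open>A i\<close> without meeting any other
    \<open>A j\<close>.\<close>
  define G where "G i = U i - (\<Union>j\<in>I-{i}. A j)" for i
  have oG: "open (G i)" if "i \<in> I" for i
    unfolding G_def using I A U that by (intro open_Diff closed_UN) (auto intro: compact_imp_closed)
  have AG: "A i \<inter> G j = {}" if "i \<in> I" "j \<in> I" "i \<noteq> j" for i j
    using that by (auto simp: G_def)
  have KG: "K \<subseteq> (\<Union>i\<in>I. G i)"
  proof
    fix x assume "x \<in> K"
    show "x \<in> (\<Union>i\<in>I. G i)"
    proof (cases "\<exists>i\<in>I. x \<in> A i")
      case True
      then obtain i where i: "i \<in> I" "x \<in> A i" by blast
      then have "x \<notin> A j" if "j \<in> I - {i}" for j
        using A(3) that unfolding disjoint_family_on_def by blast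
      then show ?thesis
        using i A(2) by (auto simp: G_def)
    next
      case False
      then show ?thesis
        using K(2) \<open>x \<in> K\<close> by (auto simp: G_def)
    qed
  qed
  \<comment> \<open>\<open>\<epsilon>\<close> is a Lebesgue number of the cover of \<open>K\<close>
    by the \<open>G i\<close>: each member of an \<open>\<epsilon>\<close>-fine family that meets
    \<open>K\<close> lies in a single \<open>G i\<close>.\<close>
  obtain \<epsilon> where \<epsilon>: "\<epsilon> > 0" "\<And>x. x \<in> K \<Longrightarrow> \<exists>i\<in>I. ball x \<epsilon> \<subseteq> G i"
    using Heine_Borel_lemma[of K "G ` I"] K(1) KG oG by (auto simp: image_iff) (metis)
  obtain \<V> where \<V>: "finite \<V>" "disjoint \<V>" "K \<subseteq> \<Union>\<V>" "\<And>V. V \<in> \<V> \<Longrightarrow> open V"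
    "\<And>V a b. V \<in> \<V> \<Longrightarrow> a \<in> V \<Longrightarrow> b \<in> V \<Longrightarrow> dist a b < \<epsilon>"
    using K(3)[OF \<epsilon>(1)] unfolding fine_separated_def by blast
  have "\<exists>i\<in>I. K \<inter> V \<subseteq> G i" if V: "V \<in> \<V>" "K \<inter> V \<noteq> {}" for V
  proof -
    obtain x where x: "x \<in> K" "x \<in> V"
      using V by blast
    then have "V \<subseteq> ball x \<epsilon>"
      using \<V>(5) V by auto
    then show ?thesis
      using \<epsilon>(2)[OF x(1)] by blast
  qed
  then obtain c where c: "\<And>V. V \<in> \<V> \<Longrightarrow> K \<inter> V \<noteq> {} \<Longrightarrow> c V \<in> I"
    "\<And>V. V \<in> \<V> \<Longrightarrow> K \<inter> V \<noteq> {} \<Longrightarrow> K \<inter> V \<subseteq> G (c V)"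
    by metis
  define \<C> where "\<C> i = {V \<in> \<V>. K \<inter> V \<noteq> {} \<and> c V = i}" for i
  define A' where "A' i = A i \<union> (\<Union>V\<in>\<C> i. K \<inter> V)" for i
  have "compact (K \<inter> V)" if "V \<in> \<V>" for V
    using compact_Int_disjoint_open[OF K(1), of UNIV \<V> V] \<V> that by simp
  then have 1: "compact (A' i)" if "i \<in> I" for i
    unfolding A'_def using A(1) that \<V>(1) by (intro compact_Un compact_UN) (auto simp: \<C>_def)
  have sub: "(\<Union>V\<in>\<C> i. K \<inter> V) \<subseteq> G i" for i
    using c by (fastforce simp: \<C>_def)
  have disj: "(\<Union>V\<in>\<C> i. K \<inter> V) \<inter> (\<Union>V\<in>\<C> j. K \<inter> V) = {}" if "i \<noteq> j" for i j
    using \<V>(2) that by (fastforce simp: \<C>_def disjoint_def)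
  have 2: "A' i \<subseteq> U i" if "i \<in> I" for i
    using A(2)[OF that] sub[of i] by (auto simp: A'_def G_def)
  have 3: "disjoint_family_on A' I"
    unfolding disjoint_family_on_def
  proof (intro ballI impI)
    fix i j assume ij: "i \<in> I" "j \<in> I" "i \<noteq> j"
    then have "A i \<inter> A j = {}"
      using A(3) by (auto simp: disjoint_family_on_def)
    moreover have "A i \<inter> (\<Union>V\<in>\<C> j. K \<inter> V) = {}" "(\<Union>V\<in>\<C> i. K \<inter> V) \<inter> A j = {}"
      using AG[of i j] AG[of j i] sub[of i] sub[of j] ij by blast+
    ultimately show "A' i \<inter> A' j = {}"
      using disj[OF ij(3)] by (simp only: A'_def Int_Un_distrib Int_Un_distrib2 Un_empty)
  qed
  have 4: "K \<subseteq> (\<Union>i\<in>I. A' i)"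
  proof
    fix x assume x: "x \<in> K"
    then obtain V where V: "V \<in> \<V>" "x \<in> V"
      using \<V>(3) by blast
    then have "c V \<in> I" "x \<in> A' (c V)"
      using c(1)[of V] x by (auto simp: A'_def \<C>_def)
    then show "x \<in> (\<Union>i\<in>I. A' i)"
      by blast
  qed
  obtain B where B: "\<And>i. i \<in> I \<Longrightarrow> compact (B i)" "\<And>i. i \<in> I \<Longrightarrow> A' i \<subseteq> interior (B i)"
    "\<And>i. i \<in> I \<Longrightarrow> B i \<subseteq> U i" "disjoint_family_on B I"
    using disjoint_compact_family_neighbourhoods[OF I 1 2 U 3] by blast
  show thesis
  proof (rule that[of B])
    show "A i \<subseteq> interior (B i)" if "i \<in> I" for i
      using B(2)[OF that] by (auto simp: A'_def)
    show "K \<subseteq> (\<Union>i\<in>I. interior (B i))"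
      using 4 B(2) by fastforce
  qed (use B in auto)
qed

text \<open>The extension step is iterated, stage \<open>k\<close> taking care of
  \<open>K k\<close>; for each \<open>U\<close> the union over all stages yields one member of a
  disjoint refinement.\<close>

lemma covering_dim_le_0_Union_fine_separated:
  fixes K :: "nat \<Rightarrow> 'a::euclidean_space set"
  assumes K: "\<And>k. compact (K k)" "\<And>k \<epsilon>. \<epsilon> > 0 \<Longrightarrow> fine_separated \<epsilon> (K k)"
  shows "covering_dim_le (top_of_set (\<Union>k. K k)) 0"
  unfolding covering_dim_le_0_iff
proof (intro allI impI, elim conjE)
  fix \<U> assume \<U>: "finite \<U>" "open_cover_of (top_of_set (\<Union>k. K k)) \<U>"
  define D where "D = (\<Union>k. K k)"
  have "\<forall>U\<in>\<U>. \<exists>T. open T \<and> U = D \<inter> T"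
    using \<U>(2) by (auto simp: open_cover_of_def openin_open D_def)
  then obtain T where T: "\<And>U. U \<in> \<U> \<Longrightarrow> open (T U)" "\<And>U. U \<in> \<U> \<Longrightarrow> U = D \<inter> T U"
    by metis
  have cov: "K k \<subseteq> (\<Union>U\<in>\<U>. T U)" for k
  proof -
    have "K k \<subseteq> \<Union>\<U>"
      using \<U>(2) by (auto simp: open_cover_of_def)
    then show ?thesis
      using T(2) by blast
  qed
  define P where "P A \<longleftrightarrow> (\<forall>U\<in>\<U>. compact (A U) \<and> A U \<subseteq> T U) \<and> disjoint_family_on A \<U>"
    for A :: "'a set \<Rightarrow> 'a set"
  define Q where "Q k A B \<longleftrightarrow> (\<forall>U\<in>\<U>. A U \<subseteq> interior (B U)) \<and> K k \<subseteq> (\<Union>U\<in>\<U>. interior (B U))"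
    for k and A B :: "'a set \<Rightarrow> 'a set"
  have ex: "\<exists>B. P B \<and> Q k A B" if "P A" for A k
  proof -
    have "compact (A U)" "A U \<subseteq> T U" "disjoint_family_on A \<U>" if "U \<in> \<U>" for U
      using \<open>P A\<close> that by (auto simp: P_def)
    moreover have "disjoint_family_on A \<U>"
      using \<open>P A\<close> by (auto simp: P_def)
    ultimately obtain B where "\<And>U. U \<in> \<U> \<Longrightarrow> compact (B U)" "\<And>U. U \<in> \<U> \<Longrightarrow> A U \<subseteq> interior (B U)"
      "\<And>U. U \<in> \<U> \<Longrightarrow> B U \<subseteq> T U" "disjoint_family_on B \<U>" "K k \<subseteq> (\<Union>U\<in>\<U>. interior (B U))"
      using fine_separated_extend[OF \<U>(1), of A T "K k", OF _ _ _ T(1) K(1) cov K(2)] by blast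
    then show ?thesis
      unfolding P_def Q_def by (intro exI[of _ B]) simp
  qed
  have "P (\<lambda>_. {})"
    by (simp add: P_def disjoint_family_on_def)
  then obtain A where A: "\<And>k. P (A k)" "\<And>k. Q k (A k) (A (Suc k))"
    using dependent_nat_choice[of "\<lambda>_. P" Q] ex by (metis (no_types, lifting))
  \<comment> \<open>Interiors make \<open>V U\<close> relatively open. Nothing is lost, since
    \<open>A k U\<close> lies in the interior of \<open>A (Suc k) U\<close>.\<close>
  define V where "V U = D \<inter> (\<Union>k. interior (A k U))" for U
  have mono: "A k U \<subseteq> A l U" if "k \<le> l" "U \<in> \<U>" for k l U
    using lift_Suc_mono_le[of "\<lambda>k. A k U"] A(2) interior_subset that unfolding Q_def by blast
  have disj: "V U \<inter> V W = {}" if "U \<in> \<U>" "W \<in> \<U>" "U \<noteq> W" for U W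
  proof (rule ccontr)
    assume "V U \<inter> V W \<noteq> {}"
    then obtain x k l where "x \<in> A k U" "x \<in> A l W"
      using interior_subset by (fastforce simp: V_def)
    \<comment> \<open>Memberships at the different stages \<open>k\<close> and \<open>l\<close> are
      compared at a common later stage, where the sets are disjoint.\<close>
    then have "x \<in> A (max k l) U \<inter> A (max k l) W"
      using mono[of k "max k l" U] mono[of l "max k l" W] that by auto
    then show False
      using A(1)[of "max k l"] that unfolding P_def disjoint_family_on_def by (metis empty_iff)
  qed
  have VU: "V U \<subseteq> U" if "U \<in> \<U>" for U
  proof -
    have "interior (A k U) \<subseteq> T U" for k
      using A(1)[of k] that interior_subset by (auto simp: P_def)
    then have "V U \<subseteq> D \<inter> T U"
      by (auto simp: V_def)
    then show ?thesis
      using T(2)[OF that] by simp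
  qed
  have DV: "D \<subseteq> (\<Union>U\<in>\<U>. V U)"
  proof -
    have "K k \<subseteq> (\<Union>U\<in>\<U>. \<Union>k. interior (A k U))" for k
    proof
      fix x assume "x \<in> K k"
      then obtain U where "U \<in> \<U>" "x \<in> interior (A (Suc k) U)"
        using A(2)[of k] unfolding Q_def by blast
      then show "x \<in> (\<Union>U\<in>\<U>. \<Union>k. interior (A k U))"
        by blast
    qed
    then show ?thesis
      unfolding D_def V_def by auto
  qed
  show "\<exists>\<V>. finite \<V> \<and> open_cover_of (top_of_set (\<Union>k. K k)) \<V> \<and> refines \<V> \<U> \<and> disjoint \<V>"
  proof (intro exI[of _ "V ` \<U>"] conjI)
    show "open_cover_of (top_of_set (\<Union>k. K k)) (V ` \<U>)"
      unfolding open_cover_of_def D_def[symmetric]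
    proof (intro conjI ballI)
      show "openin (top_of_set D) S" if "S \<in> V ` \<U>" for S
        using that by (auto simp: V_def intro: openin_open_Int)
      show "\<Union> (V ` \<U>) = topspace (top_of_set D)"
        using DV by (auto simp: V_def)
    qed
    show "refines (V ` \<U>) \<U>"
      using VU by (auto simp: refines_def)
    show "disjoint (V ` \<U>)"
      using disj by (intro disjoint_family_on_disjoint_image) (auto simp: disjoint_family_on_def)
  qed (use \<U> in auto)
qed

lemma covering_dim_le_0_homeomorphic:
  assumes "homeomorphic_map X Y f" "covering_dim_le X 0"
  shows "covering_dim_le Y 0"
  unfolding covering_dim_le_0_iff
proof (intro allI impI, elim conjE)
  fix \<U> assume \<U>: "finite \<U>" "open_cover_of Y \<U>"
  obtain g where hom: "homeomorphic_maps X Y f g"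
    using assms(1) homeomorphic_map_maps by blast
  then have g: "homeomorphic_map Y X g"
    using homeomorphic_maps_map by blast
  have fg: "f (g y) = y" if "y \<in> topspace Y" for y
    using hom that by (simp add: homeomorphic_maps_def)
  have "open_cover_of X (image g ` \<U>)"
    using \<U>(2) g homeomorphic_map_openness_eq[OF g] homeomorphic_imp_surjective_map[OF g]
    unfolding open_cover_of_def by (metis (no_types, opaque_lifting) imageE image_Union)
  then obtain \<V> where \<V>: "finite \<V>" "open_cover_of X \<V>" "refines \<V> (image g ` \<U>)" "disjoint \<V>"
    using assms(2) \<U>(1) unfolding covering_dim_le_0_iff by (meson finite_imageI)
  show "\<exists>\<V>. finite \<V> \<and> open_cover_of Y \<V> \<and> refines \<V> \<U> \<and> disjoint \<V>"
  proof (intro exI[of _ "image f ` \<V>"] conjI)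
    show "open_cover_of Y (image f ` \<V>)"
      using \<V>(2) homeomorphic_map_openness_eq[OF assms(1)] homeomorphic_imp_surjective_map[OF assms(1)]
      unfolding open_cover_of_def by (metis (no_types, opaque_lifting) imageE image_Union)
    show "refines (image f ` \<V>) \<U>"
      unfolding refines_def
    proof
      fix S assume "S \<in> image f ` \<V>"
      then obtain V where V: "V \<in> \<V>" "S = f ` V" by blast
      then obtain U where U: "U \<in> \<U>" "V \<subseteq> g ` U"
        using \<V>(3) unfolding refines_def by blast
      have "U \<subseteq> topspace Y"
        using \<U>(2) U(1) by (auto simp: open_cover_of_def)
      then have "f ` V \<subseteq> U"
        using fg U(2) by force
      then show "\<exists>U\<in>\<U>. S \<subseteq> U"
        using U V by blast
    qed
    have "inj_on f (\<Union>\<V>)"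
      using \<V>(2) assms(1) by (simp add: open_cover_of_def homeomorphic_eq_everything_map)
    then have "f ` V \<inter> f ` W = f ` (V \<inter> W)" if "V \<in> \<V>" "W \<in> \<V>" for V W
      using that by (intro inj_on_image_Int[symmetric]) auto
    moreover have "V \<inter> W = {}" if "V \<in> \<V>" "W \<in> \<V>" "f ` V \<noteq> f ` W" for V W
      using \<V>(4) that unfolding disjoint_def by blast
    ultimately show "disjoint (image f ` \<V>)"
      unfolding disjoint_def by (auto simp del: image_Int)
  qed (use \<V> in auto)
qed

subsection \<open>Lines through a point\<close>

declare One_nat_def [simp del]

lemma atMost_1_nat: "{..1::nat} = {0, 1}"
  by auto

text \<open>The point of projective space (as a rank one projection) spanned by \<open>v \<noteq> 0\<close>.\<close>

definition direction :: "real ^ 'm \<Rightarrow> real ^ 'm ^ 'm" where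
  "direction v = (\<chi> i j. v $ i * v $ j / (v \<bullet> v))"

text \<open>The projection onto the line of \<open>v\<close> fixes \<open>v\<close>. If it is also
  the projection onto the line of \<open>w\<close>, then \<open>v\<close> is its own projection onto
  \<open>w\<close>, with coefficient \<open>(w \<bullet> v) / (w \<bullet> w)\<close>.\<close>

lemma direction_eq_iff:
  assumes "v \<noteq> 0" "w \<noteq> 0"
  shows "direction v = direction w \<longleftrightarrow> (\<exists>c. v = c *\<^sub>R w)"
proof
  assume eq: "direction v = direction w"
  have "v $ i = ((w \<bullet> v) / (w \<bullet> w)) * w $ i" for i
  proof -
    have "v $ i = (\<Sum>j\<in>UNIV. direction v $ i $ j * v $ j)"
    proof -
      have "(\<Sum>j\<in>UNIV. direction v $ i $ j * v $ j) = (\<Sum>j\<in>UNIV. (v $ i / (v \<bullet> v)) * (v $ j * v $ j))"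
        by (simp add: direction_def mult.assoc)
      also have "\<dots> = (v $ i / (v \<bullet> v)) * (v \<bullet> v)"
        by (simp add: inner_vec_def sum_distrib_left)
      finally show ?thesis using assms(1) by simp
    qed
    also have "\<dots> = (\<Sum>j\<in>UNIV. (w $ i / (w \<bullet> w)) * (w $ j * v $ j))"
      unfolding eq by (simp add: direction_def mult.assoc)
    also have "\<dots> = (w $ i / (w \<bullet> w)) * (w \<bullet> v)"
      by (simp add: inner_vec_def sum_distrib_left)
    finally show ?thesis by simp
  qed
  then have "v = ((w \<bullet> v) / (w \<bullet> w)) *\<^sub>R w"
    by (simp add: vec_eq_iff)
  then show "\<exists>c. v = c *\<^sub>R w" ..
next
  assume "\<exists>c. v = c *\<^sub>R w"
  then obtain c where c: "v = c *\<^sub>R w" ..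
  with assms have "c \<noteq> 0" by auto
  then show "direction v = direction w"
    using assms by (simp add: c direction_def vec_eq_iff field_simps)
qed

lemma continuous_on_direction: "continuous_on (- {0}) direction"
  unfolding direction_def by (intro continuous_intros) auto

text \<open>The choice of two points is immaterial on \<open>planes 1\<close>, by
  \<open>line_direction_eq\<close>; choosing avoids fixing a base point on the line.\<close>

definition line_direction :: "(real ^ 'm) set \<Rightarrow> real ^ 'm ^ 'm" where
  "line_direction L = (SOME M. \<exists>a\<in>L. \<exists>b\<in>L. a \<noteq> b \<and> M = direction (b - a))"

lemma affine_hull_2_in_planes_1: "a \<noteq> b \<Longrightarrow> affine hull {a, b} \<in> planes 1"
  by (simp add: planes_def affine_affine_hull aff_dim_2)

lemma planes_1_cases:
  assumes "L \<in> planes 1"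
  obtains a b where "a \<noteq> b" "L = affine hull {a, b}"
proof -
  obtain p where p: "p \<in> topspace (aff_frames 1)" "L = plane_span 1 p"
    using assms quotient_imp_surjective_map[OF quotient_map_plane_span[of 1]]
    by (metis imageE topspace_plane_space)
  have "p 0 \<noteq> p 1"
    using p(1) by (simp add: aff_frames_def atMost_1_nat)
  then show thesis
    using p(2) by (intro that[of "p 0" "p 1"]) (simp_all add: plane_span_def atMost_1_nat)
qed

lemma affine_hull_2_eq_range:
  fixes a b :: "'a::real_vector"
  shows "affine hull {a, b} = range (\<lambda>t. a + t *\<^sub>R (b - a))"
  unfolding affine_hull_2
proof (intro subset_antisym subsetI)
  fix x assume "x \<in> {u *\<^sub>R a + v *\<^sub>R b |u v. u + v = 1}"
  then obtain u v where "x = u *\<^sub>R a + v *\<^sub>R b" "u + v = 1"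
    by blast
  moreover from this have "u = 1 - v"
    by simp
  ultimately have "x = a + v *\<^sub>R (b - a)"
    by (simp add: algebra_simps)
  then show "x \<in> range (\<lambda>t. a + t *\<^sub>R (b - a))"
    by blast
next
  fix x assume "x \<in> range (\<lambda>t. a + t *\<^sub>R (b - a))"
  then obtain t where "x = a + t *\<^sub>R (b - a)"
    by blast
  then have "x = (1 - t) *\<^sub>R a + t *\<^sub>R b"
    by (simp add: algebra_simps)
  then show "x \<in> {u *\<^sub>R a + v *\<^sub>R b |u v. u + v = 1}"
    by force
qed

lemma planes_1_eq_affine_hull:
  assumes "L \<in> planes 1" "a \<in> L" "b \<in> L" "a \<noteq> b"
  shows "L = affine hull {a, b}"
proof -
  have "affine L" "aff_dim L = 1"
    using assms(1) by (auto simp: planes_def)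
  moreover have "affine hull {a, b} \<subseteq> L"
    using assms \<open>affine L\<close> by (intro hull_minimal) auto
  ultimately have "affine hull {a, b} = L"
    using assms(4) by (intro affine_dim_equal) (auto simp: aff_dim_2 affine_affine_hull)
  then show ?thesis ..
qed

text \<open>Any two points of a line differ by a multiple of one fixed vector, so the choice in
  \<open>line_direction\<close> has only one possible value.\<close>

lemma line_direction_eq:
  assumes "L \<in> planes 1" "a \<in> L" "b \<in> L" "a \<noteq> b"
  shows "line_direction L = direction (b - a)"
proof -
  obtain p q where L: "L = affine hull {p, q}" and "p \<noteq> q"
    using planes_1_cases[OF assms(1)] by metis
  have "direction (y - x) = direction (q - p)" if xy: "x \<in> L" "y \<in> L" "x \<noteq> y" for x y
  proof -
    obtain s t where "x = p + s *\<^sub>R (q - p)" "y = p + t *\<^sub>R (q - p)"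
      using xy(1,2) by (auto simp: L affine_hull_2_eq_range)
    then have "y - x = (t - s) *\<^sub>R (q - p)"
      by (simp add: scaleR_left_diff_distrib)
    then show ?thesis
      using xy(3) \<open>p \<noteq> q\<close> by (subst direction_eq_iff) auto
  qed
  then have *: "(\<exists>x\<in>L. \<exists>y\<in>L. x \<noteq> y \<and> M = direction (y - x)) \<longleftrightarrow> M = direction (b - a)" for M
    using assms by metis
  show ?thesis
    unfolding line_direction_def * by simp
qed

text \<open>\<open>plane_space 1\<close> carries the quotient topology, so continuity can be tested
  on frames, where the map is \<open>direction (p 1 - p 0)\<close> with a nonzero argument.\<close>

lemma continuous_map_line_direction:
  "continuous_map (plane_space 1) euclidean (line_direction :: (real ^ 'm) set \<Rightarrow> _)"
proof -
  let ?f = "\<lambda>p :: nat \<Rightarrow> real ^ 'm. p 1 - p 0"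
  have p: "p 0 \<noteq> p 1" if "p \<in> topspace (aff_frames 1)" for p :: "nat \<Rightarrow> real ^ 'm"
    using that by (auto simp: aff_frames_def atMost_1_nat)
  have "continuous_map (aff_frames 1) euclidean ?f"
    unfolding aff_frames_def
    by (intro continuous_map_from_subtopology continuous_map_diff continuous_map_product_projection) auto
  moreover have "?f ` topspace (aff_frames 1) \<subseteq> - {0}"
  proof (clarsimp)
    fix q :: "nat \<Rightarrow> real ^ 'm" assume "q \<in> topspace (aff_frames 1)" "q 1 = q 0"
    then show False using p[of q] by simp
  qed
  ultimately have "continuous_map (aff_frames 1) (top_of_set (- {0})) ?f"
    by (auto simp: continuous_map_in_subtopology)
  then have "continuous_map (aff_frames 1) euclidean (direction \<circ> ?f)"
    by (rule continuous_map_compose) (use continuous_on_direction in simp)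
  moreover have "line_direction (plane_span 1 p) = (direction \<circ> ?f) p"
    if "p \<in> topspace (aff_frames 1)" for p :: "nat \<Rightarrow> real ^ 'm"
    unfolding o_def
    by (rule line_direction_eq[OF plane_span_in_planes[OF that]])
      (use p[OF that] in \<open>auto simp: plane_span_def atMost_1_nat intro: hull_inc\<close>)
  ultimately have "continuous_map (aff_frames 1) euclidean
      (line_direction \<circ> (plane_span 1 :: _ \<Rightarrow> (real ^ 'm) set))"
    by (auto intro: continuous_map_eq)
  then show ?thesis
    using continuous_compose_quotient_map[OF quotient_map_plane_span] by blast
qed

section \<open>The pencil of lines through a point, embedded by direction\<close>

lemma planes_1_other_point:
  assumes "L \<in> planes 1"
  obtains w where "w \<in> L" "w \<noteq> z"
proof -
  obtain a b where "a \<noteq> b" "L = affine hull {a, b}"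
    using planes_1_cases[OF assms] .
  then have "a \<in> L" "b \<in> L" "a \<noteq> b"
    by (auto intro: hull_inc)
  then show thesis
    using that by metis
qed

text \<open>The unit sphere maps continuously onto the pencil by sending \<open>v\<close> to the
  line through \<open>z\<close> and \<open>z + v\<close>.\<close>

lemma compactin_lines_through:
  "compactin (plane_space 1) {L \<in> planes 1. (z :: real ^ 'm) \<in> L}"
proof -
  \<comment> \<open>Frames are extensional on \<open>{..1}\<close>, hence the restricted
    abstraction.\<close>
  define f where "f v = (\<lambda>i\<in>{..1::nat}. if i = 0 then z else z + v)" for v
  have cont: "continuous_map (top_of_set (sphere 0 1)) (aff_frames 1) f"
    unfolding aff_frames_def continuous_map_in_subtopology continuous_map_componentwise
  proof (intro conjI ballI)
    fix i :: nat assume "i \<in> {..1}"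
    then show "continuous_map (top_of_set (sphere 0 1)) euclidean (\<lambda>v. f v i)"
      by (cases "i = 0") (auto simp: f_def intro!: continuous_intros)
  next
    have "inj_on (f v) {..1} \<and> \<not> affine_dependent (f v ` {..1})" if "norm v = 1" for v
    proof -
      have "z \<noteq> z + v"
        using that by auto
      then show ?thesis
        by (simp add: f_def atMost_1_nat)
    qed
    then show "f \<in> topspace (top_of_set (sphere 0 1)) \<rightarrow>
        {p. inj_on p {..1} \<and> \<not> affine_dependent (p ` {..1})}"
      by auto
  qed (auto simp: f_def)
  have "continuous_map (top_of_set (sphere 0 1)) (plane_space 1) (plane_span 1 \<circ> f)"
    using cont quotient_imp_continuous_map[OF quotient_map_plane_span] by (rule continuous_map_compose)
  then have "compactin (plane_space 1) ((plane_span 1 \<circ> f) ` sphere 0 1)"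
    by (rule image_compactin[rotated]) (simp add: compactin_subtopology)
  moreover have "(plane_span 1 \<circ> f) ` sphere 0 1 = {L \<in> planes 1. z \<in> L}"
  proof (intro subset_antisym subsetI)
    fix L assume "L \<in> (plane_span 1 \<circ> f) ` sphere 0 1"
    then obtain v where "norm v = 1" "L = affine hull {z, z + v}"
      by (auto simp: plane_span_def f_def atMost_1_nat insert_commute)
    then show "L \<in> {L \<in> planes 1. z \<in> L}"
      using affine_hull_2_in_planes_1[of z "z + v"] by (cases "v = 0") (auto simp: hull_inc)
  next
    fix L assume L: "L \<in> {L \<in> planes 1. z \<in> L}"
    obtain w where w: "w \<in> L" "w \<noteq> z"
      using planes_1_other_point L by blast
    define v where "v = (w - z) /\<^sub>R norm (w - z)"
    have v: "norm v = 1"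
      using w by (simp add: v_def)
    have "z + v \<in> affine hull {z, w}"
      unfolding affine_hull_2_eq_range v_def by blast
    also have "\<dots> = L"
      using planes_1_eq_affine_hull[of L z w] L w by auto
    finally have "L = affine hull {z, z + v}"
      using v L by (intro planes_1_eq_affine_hull) auto
    then have "L = (plane_span 1 \<circ> f) v"
      by (simp add: plane_span_def f_def atMost_1_nat insert_commute)
    then show "L \<in> (plane_span 1 \<circ> f) ` sphere 0 1"
      using v by auto
  qed
  ultimately show ?thesis by simp
qed

text \<open>A continuous injection of a compact space into a Hausdorff space is an embedding.
  Injectivity holds because all these lines share the point \<open>z\<close>.\<close>

lemma embedding_map_line_direction:
  "embedding_map (subtopology (plane_space 1) {L \<in> planes 1. z \<in> L}) euclidean
     (line_direction :: (real ^ 'm) set \<Rightarrow> _)"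
proof (rule continuous_imp_embedding_map)
  show "compact_space (subtopology (plane_space 1) {L \<in> planes 1. z \<in> L})"
    using compactin_lines_through[of z] compactin_subspace by blast
  show "inj_on (line_direction :: (real ^ 'm) set \<Rightarrow> _)
     (topspace (subtopology (plane_space 1) {L \<in> planes 1. z \<in> L}))"
  proof (rule inj_onI)
    fix L L' :: "(real ^ 'm) set"
    assume L: "L \<in> topspace (subtopology (plane_space 1) {L \<in> planes 1. z \<in> L})"
      and L': "L' \<in> topspace (subtopology (plane_space 1) {L \<in> planes 1. z \<in> L})"
      and eq: "line_direction L = line_direction L'"
    have "L \<in> planes 1" "L' \<in> planes 1"
      using L L' by auto
    then obtain w w' where w: "w \<in> L" "w \<noteq> z" and w': "w' \<in> L'" "w' \<noteq> z"
      using planes_1_other_point[of L z thesis] planes_1_other_point[of L' z thesis] by metis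
    have "direction (w - z) = direction (w' - z)"
      using eq line_direction_eq[of L z w] line_direction_eq[of L' z w'] L L' w w' by auto
    then obtain c where "w - z = c *\<^sub>R (w' - z)"
      using w w' by (subst (asm) direction_eq_iff) auto
    then have "w = z + c *\<^sub>R (w' - z)"
      by (simp add: algebra_simps)
    then have "w \<in> affine hull {z, w'}"
      unfolding affine_hull_2_eq_range by blast
    also have "\<dots> = L'"
      using planes_1_eq_affine_hull[of L' z w'] L' w' by auto
    finally have "w \<in> L'" .
    then show "L = L'"
      using planes_1_eq_affine_hull[of L z w] planes_1_eq_affine_hull[of L' z w] L L' w by auto
  qed
qed (auto intro: continuous_map_from_subtopology continuous_map_line_direction)

text \<open>Distinctness is required of \<open>x\<close> and \<open>y\<close>, not of their images:
  two points with the same image count as two preimages of the line.\<close>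

definition secant_directions ::
    "'a topology \<Rightarrow> ('a \<Rightarrow> real ^ 'm) \<Rightarrow> real ^ 'm \<Rightarrow> (real ^ 'm ^ 'm) set" where
  "secant_directions X g z = {P. \<exists>x\<in>topspace X. \<exists>y\<in>topspace X. x \<noteq> y \<and>
     P = direction (g x - z) \<and> P = direction (g y - z)}"

text \<open>Off the image of \<open>g\<close> the vectors \<open>g x - z\<close> are nonzero, and
  two of them have equal directions exactly when both image points lie on one line through
  \<open>z\<close>.\<close>

lemma line_direction_plane_preimages:
  assumes z: "z \<notin> g ` topspace X"
  shows "line_direction ` plane_preimages X 2 1 g z = secant_directions X g z"
proof (intro subset_antisym subsetI)
  fix M assume "M \<in> line_direction ` plane_preimages X 2 1 g z"
  then obtain L F where L: "M = line_direction L" "L \<in> planes 1" "z \<in> L"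
    and F: "F \<subseteq> {x \<in> topspace X. g x \<in> L}" "card F = 2"
    unfolding plane_preimages_def by blast
  obtain x y where "F = {x, y}" "x \<noteq> y"
    using F(2) by (auto simp: card_2_iff)
  then have xy: "x \<in> topspace X" "y \<in> topspace X" "x \<noteq> y" "g x \<in> L" "g y \<in> L"
    using F(1) by auto
  then have "M = direction (g x - z)" "M = direction (g y - z)"
    using line_direction_eq[of L z "g x"] line_direction_eq[of L z "g y"] L z by auto
  then show "M \<in> secant_directions X g z"
    unfolding secant_directions_def using xy(1-3) by blast
next
  fix M assume "M \<in> secant_directions X g z"
  then obtain x y where M: "M = direction (g x - z)" "M = direction (g y - z)"
    and xy: "x \<in> topspace X" "y \<in> topspace X" "x \<noteq> y"
    by (auto simp: secant_directions_def)
  have nz: "g x \<noteq> z" "g y \<noteq> z"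
    using xy z by auto
  then obtain c where "g y - z = c *\<^sub>R (g x - z)"
    using M direction_eq_iff[of "g y - z" "g x - z"] by auto
  then have "g y = z + c *\<^sub>R (g x - z)"
    by (simp add: algebra_simps)
  moreover define L where "L = affine hull {z, g x}"
  ultimately have "g y \<in> L"
    unfolding affine_hull_2_eq_range by blast
  moreover have "L \<in> planes 1" "z \<in> L" "g x \<in> L"
    using nz by (auto simp: L_def affine_hull_2_in_planes_1 hull_inc)
  ultimately have L: "L \<in> planes 1" "z \<in> L" "g x \<in> L" "g y \<in> L"
    by simp_all
  then have "line_direction L = M"
    using line_direction_eq[of L z "g x"] nz M by auto
  moreover have "L \<in> plane_preimages X 2 1 g z"
    unfolding plane_preimages_def using L xy by (auto intro!: exI[of _ "{x, y}"])
  ultimately show "M \<in> line_direction ` plane_preimages X 2 1 g z"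
    by blast
qed

text \<open>This moves the dimension question from the quotient space of lines to a subset of a
  Euclidean space of matrices, where metric arguments are available.\<close>

lemma homeomorphic_map_plane_preimages:
  assumes "z \<notin> g ` topspace X"
  shows "homeomorphic_map (subtopology (plane_space 1) (plane_preimages X 2 1 g z))
    (top_of_set (secant_directions X g z)) line_direction"
proof -
  let ?Q = "{L \<in> planes 1. z \<in> L}"
  have "plane_preimages X 2 1 g z \<subseteq> ?Q"
    by (auto simp: plane_preimages_def)
  moreover have "homeomorphic_map (subtopology (plane_space 1) ?Q)
     (subtopology euclidean (line_direction ` ?Q)) line_direction"
    using embedding_map_line_direction[of z] unfolding embedding_map_def by (simp add: Int_def)
  ultimately have "homeomorphic_map (subtopology (subtopology (plane_space 1) ?Q) (plane_preimages X 2 1 g z))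
     (subtopology (subtopology euclidean (line_direction ` ?Q)) (secant_directions X g z)) line_direction"
    unfolding line_direction_plane_preimages[OF assms, symmetric]
    by (elim homeomorphic_map_subtopologies) (simp add: Int_absorb1, blast)
  moreover have "secant_directions X g z \<subseteq> line_direction ` ?Q"
    unfolding line_direction_plane_preimages[OF assms, symmetric] by (auto simp: plane_preimages_def)
  ultimately show ?thesis
    using \<open>plane_preimages X 2 1 g z \<subseteq> ?Q\<close>
    by (simp add: subtopology_subtopology Int_absorb1)
qed

subsection \<open>Lines meeting the image of two distant points\<close>

text \<open>The non-strict \<open>r \<le> d x y\<close> survives passage to limits, which is what
  makes these sets compact; for a metric \<open>d\<close> and \<open>r > 0\<close> it also excludes
  \<open>x = y\<close>.\<close>

definition far_secants ::
    "'a set \<Rightarrow> ('a \<Rightarrow> 'a \<Rightarrow> real) \<Rightarrow> real \<Rightarrow> ('a \<Rightarrow> real ^ 'm) \<Rightarrow> real ^ 'm \<Rightarrow> (real ^ 'm ^ 'm) set" where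
  "far_secants M d r g z = {P. \<exists>x\<in>M. \<exists>y\<in>M. r \<le> d x y \<and>
     P = direction (g x - z) \<and> P = direction (g y - z)}"

lemma far_secants_cong:
  assumes "\<And>x. x \<in> M \<Longrightarrow> g x = h x"
  shows "far_secants M d r g z = far_secants M d r h z"
  by (simp add: far_secants_def assms cong: bex_cong)

lemma far_secants_antimono: "r' \<le> r \<Longrightarrow> far_secants M d r g z \<subseteq> far_secants M d r' g z"
  unfolding far_secants_def by (blast intro: order_trans)

context Metric_space
begin

lemma secant_directions_eq_Union_far_secants:
  "secant_directions mtopology g z = (\<Union>i. far_secants M d (inverse (real (Suc i))) g z)"
proof (intro subset_antisym subsetI)
  fix P assume "P \<in> secant_directions mtopology g z"
  then obtain x y where xy: "x \<in> M" "y \<in> M" "x \<noteq> y" "P = direction (g x - z)" "P = direction (g y - z)"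
    by (auto simp: secant_directions_def)
  then obtain i where "inverse (real (Suc i)) < d x y"
    using reals_Archimedean[of "d x y"] by auto
  then have "P \<in> far_secants M d (inverse (real (Suc i))) g z"
    unfolding far_secants_def using xy less_imp_le by blast
  then show "P \<in> (\<Union>i. far_secants M d (inverse (real (Suc i))) g z)"
    by blast
next
  fix P assume "P \<in> (\<Union>i. far_secants M d (inverse (real (Suc i))) g z)"
  then obtain i x y where "x \<in> M" "y \<in> M" "inverse (real (Suc i)) \<le> d x y"
      "P = direction (g x - z)" "P = direction (g y - z)"
    unfolding far_secants_def by blast
  moreover from this have "0 < d x y"
    by (rule_tac less_le_trans[of _ "inverse (real (Suc i))"]) simp_all
  then have "x \<noteq> y"
    using \<open>x \<in> M\<close> by auto
  ultimately show "P \<in> secant_directions mtopology g z"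
    unfolding secant_directions_def topspace_mtopology by blast
qed

text \<open>By compactness the witnesses of the \<open>P i\<close> converge along a common
  subsequence, and their limits witness the limit direction. Constant \<open>G\<close> and
  \<open>Z\<close> give compactness of the far secants, varying ones the stability under
  perturbation.\<close>

lemma far_secants_subsequence:
  fixes g :: "'a \<Rightarrow> real ^ 'm"
  assumes X: "compact_space mtopology" and g: "continuous_map mtopology euclidean g"
    and G: "\<And>i x. x \<in> M \<Longrightarrow> dist (g x) (G i x) \<le> e i" "e \<longlonglongrightarrow> 0"
    and Z: "Z \<longlonglongrightarrow> z" "z \<notin> g ` M"
    and P: "\<And>i. P i \<in> far_secants M d r (G i) (Z i)"
  obtains s l where "strict_mono s" "l \<in> far_secants M d r g z" "(P \<circ> s) \<longlonglongrightarrow> l"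
proof -
  have "\<forall>i. \<exists>x y. x \<in> M \<and> y \<in> M \<and> r \<le> d x y \<and> P i = direction (G i x - Z i) \<and> P i = direction (G i y - Z i)"
    using P unfolding far_secants_def by blast
  then obtain x y where xy: "\<And>i. x i \<in> M" "\<And>i. y i \<in> M" "\<And>i. r \<le> d (x i) (y i)"
    "\<And>i. P i = direction (G i (x i) - Z i)" "\<And>i. P i = direction (G i (y i) - Z i)"
    by metis
  obtain a s1 where a: "a \<in> M" "strict_mono s1" "limitin mtopology (x \<circ> s1) a sequentially"
    using X xy(1) unfolding compact_space_sequentially by (meson image_subsetI)
  obtain b s2 where b: "b \<in> M" "strict_mono s2" "limitin mtopology (y \<circ> s1 \<circ> s2) b sequentially"
  proof -
    have "range (y \<circ> s1) \<subseteq> M"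
      using xy(2) by auto
    then show thesis
      using X that unfolding compact_space_sequentially by blast
  qed
  define s where "s = s1 \<circ> s2"
  have s: "strict_mono s"
    using a(2) b(2) by (simp add: s_def strict_mono_o)
  have lx: "limitin mtopology (x \<circ> s) a sequentially"
    using limitin_subsequence[OF b(2) a(3)] by (simp add: s_def o_assoc)
  have ly: "limitin mtopology (y \<circ> s) b sequentially"
    using b(3) by (simp add: s_def o_assoc)
  \<comment> \<open>One limit computation serves both sequences of witnesses. As \<open>z\<close> is
    off the image, the limit vector \<open>g c - z\<close> is nonzero and \<open>direction\<close>
    is continuous there.\<close>
  have *: "(P \<circ> s) \<longlonglongrightarrow> direction (g c - z)"
    if w: "limitin mtopology (w \<circ> s) c sequentially" "c \<in> M" "\<And>i. w i \<in> M"
      "\<And>i. P i = direction (G i (w i) - Z i)" for w c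
  proof -
    have "limitin euclidean (g \<circ> (w \<circ> s)) (g c) sequentially"
      using g w(1) by (rule continuous_map_limit)
    then have 1: "(\<lambda>i. g (w (s i))) \<longlonglongrightarrow> g c"
      by (simp add: o_def)
    have es: "(\<lambda>i. e (s i)) \<longlonglongrightarrow> 0"
      using LIMSEQ_subseq_LIMSEQ[OF G(2) s] by (simp add: o_def)
    have "(\<lambda>i. G (s i) (w (s i)) - g (w (s i))) \<longlonglongrightarrow> 0"
    proof (rule Lim_null_comparison[OF _ es], rule always_eventually, rule allI)
      show "norm (G (s i) (w (s i)) - g (w (s i))) \<le> e (s i)" for i
        using G(1)[OF w(3), of "s i" "s i"] by (simp add: dist_norm norm_minus_commute)
    qed
    from tendsto_add[OF this 1] have "(\<lambda>i. G (s i) (w (s i))) \<longlonglongrightarrow> g c"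
      by simp
    moreover have "(\<lambda>i. Z (s i)) \<longlonglongrightarrow> z"
      using LIMSEQ_subseq_LIMSEQ[OF Z(1) s] by (simp add: o_def)
    ultimately have "(\<lambda>i. G (s i) (w (s i)) - Z (s i)) \<longlonglongrightarrow> g c - z"
      by (rule tendsto_diff)
    moreover have "isCont direction (g c - z)"
    proof -
      have "g c - z \<in> - {0}"
        using Z(2) w(2) by auto
      then show ?thesis
        using continuous_on_direction continuous_on_eq_continuous_at[of "- {0}" direction] by blast
    qed
    ultimately have "(\<lambda>i. direction (G (s i) (w (s i)) - Z (s i))) \<longlonglongrightarrow> direction (g c - z)"
      by (rule isCont_tendsto_compose[rotated])
    then show ?thesis
      by (simp add: o_def w(4))
  qed
  have "direction (g a - z) = direction (g b - z)"
    using *[OF lx a(1) xy(1,4)] *[OF ly b(1) xy(2,5)] by (rule LIMSEQ_unique)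
  moreover have "r \<le> d a b"
  proof -
    have "(\<lambda>i. d (x (s i)) a) \<longlonglongrightarrow> 0" "(\<lambda>i. d (y (s i)) b) \<longlonglongrightarrow> 0"
      using lx ly by (auto simp: limitin_metric_dist_null o_def)
    then have "(\<lambda>i. d (x (s i)) a + d a b + d (y (s i)) b) \<longlonglongrightarrow> 0 + d a b + 0"
      by (intro tendsto_intros)
    moreover have "r \<le> d (x (s i)) a + d a b + d (y (s i)) b" for i
      using xy(3)[of "s i"] triangle[OF xy(1) a(1) xy(2), of "s i" "s i"]
        triangle[OF a(1) b(1) xy(2), of "s i"] commute[of b "y (s i)"] by linarith
    ultimately show ?thesis
      using LIMSEQ_le_const[of "\<lambda>i. d (x (s i)) a + d a b + d (y (s i)) b" "0 + d a b + 0" r] by simp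
  qed
  ultimately have "direction (g a - z) \<in> far_secants M d r g z"
    unfolding far_secants_def using a(1) b(1) by blast
  then show thesis
    using s *[OF lx a(1) xy(1,4)] by (intro that)
qed

lemma compact_far_secants:
  fixes g :: "'a \<Rightarrow> real ^ 'm"
  assumes "compact_space mtopology" "continuous_map mtopology euclidean g" "z \<notin> g ` M"
  shows "compact (far_secants M d r g z)"
  unfolding compact_def
proof (intro allI impI)
  fix P :: "nat \<Rightarrow> real ^ 'm ^ 'm" assume "\<forall>i. P i \<in> far_secants M d r g z"
  then show "\<exists>l\<in>far_secants M d r g z. \<exists>s. strict_mono s \<and> (P \<circ> s) \<longlonglongrightarrow> l"
    using far_secants_subsequence[OF assms(1,2), of "\<lambda>_. g" "\<lambda>_. 0" "\<lambda>_. z" z P r] assms(3)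
    by (metis dist_self order_refl tendsto_const)
qed

text \<open>If no \<open>\<delta>\<close> worked, there would be maps tending uniformly to
  \<open>g\<close> with bad points \<open>Z i\<close>. The bound \<open>1/r\<close> lets the
  \<open>Z i\<close> accumulate at some \<open>z\<close>, and the lower bound \<open>r\<close> on
  distances keeps \<open>z\<close> off the image of \<open>g\<close>.\<close>

lemma fine_separated_far_secants_stable:
  fixes g :: "'a \<Rightarrow> real ^ 'm"
  assumes X: "compact_space mtopology" and g: "continuous_map mtopology euclidean g" and "r > 0"
    and fine: "\<And>z. z \<notin> g ` M \<Longrightarrow> fine_separated r (far_secants M d r g z)"
  obtains \<delta> where "\<delta> > 0"
    "\<And>h z. \<lbrakk>\<And>x. x \<in> M \<Longrightarrow> dist (g x) (h x) \<le> \<delta>; norm z \<le> 1/r; \<And>x. x \<in> M \<Longrightarrow> r \<le> dist z (h x)\<rbrakk>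
       \<Longrightarrow> fine_separated r (far_secants M d r h z)"
proof (rule ccontr)
  assume not: "\<not> thesis"
  have "\<exists>h z. (\<forall>x\<in>M. dist (g x) (h x) \<le> inverse (real (Suc i))) \<and> norm z \<le> 1/r \<and>
      (\<forall>x\<in>M. r \<le> dist z (h x)) \<and> \<not> fine_separated r (far_secants M d r h z)" for i
    using not that[of "inverse (real (Suc i))"]
    by (metis inverse_positive_iff_positive of_nat_0_less_iff zero_less_Suc)
  then obtain H Z where H: "\<And>i x. x \<in> M \<Longrightarrow> dist (g x) (H i x) \<le> inverse (real (Suc i))"
      "\<And>i. norm (Z i) \<le> 1/r" "\<And>i x. x \<in> M \<Longrightarrow> r \<le> dist (Z i) (H i x)"
      "\<And>i. \<not> fine_separated r (far_secants M d r (H i) (Z i))"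
    by metis
  have "compact (cball (0 :: real ^ 'm) (1/r))" "\<forall>i. Z i \<in> cball 0 (1/r)"
    using H(2) by auto
  then obtain z s where s: "strict_mono s" "(Z \<circ> s) \<longlonglongrightarrow> z"
    unfolding compact_def by meson
  have e: "(\<lambda>i. inverse (real (Suc (s i)))) \<longlonglongrightarrow> 0"
    using LIMSEQ_subseq_LIMSEQ[OF LIMSEQ_inverse_real_of_nat s(1)] by (simp add: o_def)
  have "r \<le> dist z (g x)" if x: "x \<in> M" for x
  proof -
    have "(\<lambda>i. dist (Z (s i)) (g x) + inverse (real (Suc (s i)))) \<longlonglongrightarrow> dist z (g x) + 0"
      using s(2) e by (intro tendsto_intros) (auto simp: o_def)
    moreover have "r \<le> dist (Z (s i)) (g x) + inverse (real (Suc (s i)))" for i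
      using H(1)[OF x, of "s i"] H(3)[OF x, of "s i"] dist_triangle[of "Z (s i)" "H (s i) x" "g x"]
      by linarith
    ultimately show ?thesis
      using LIMSEQ_le_const by fastforce
  qed
  with \<open>r > 0\<close> have z: "z \<notin> g ` M"
    by fastforce
  obtain \<V> where \<V>: "finite \<V>" "disjoint \<V>" "far_secants M d r g z \<subseteq> \<Union>\<V>"
    "\<And>V. V \<in> \<V> \<Longrightarrow> open V" "\<And>V a b. V \<in> \<V> \<Longrightarrow> a \<in> V \<Longrightarrow> b \<in> V \<Longrightarrow> dist a b < r"
    using fine[OF z] unfolding fine_separated_def by blast
  \<comment> \<open>The family that separates the far secants at the limit \<open>z\<close> cannot
    cover those of any \<open>H i\<close>. The missed directions accumulate at a far secant of
    \<open>g\<close>, outside the open set \<open>\<Union>\<V>\<close>, which is absurd.\<close>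
  have "\<exists>P. P \<in> far_secants M d r (H i) (Z i) \<and> P \<notin> \<Union>\<V>" for i
  proof (rule ccontr)
    assume "\<nexists>P. P \<in> far_secants M d r (H i) (Z i) \<and> P \<notin> \<Union>\<V>"
    then have "fine_separated r (far_secants M d r (H i) (Z i))"
      unfolding fine_separated_def using \<V> by (intro exI[of _ \<V>]) auto
    then show False
      using H(4) by blast
  qed
  then obtain P where P: "\<And>i. P i \<in> far_secants M d r (H i) (Z i)" "\<And>i. P i \<notin> \<Union>\<V>"
    by metis
  obtain t l where t: "strict_mono t" "l \<in> far_secants M d r g z" "(P \<circ> s \<circ> t) \<longlonglongrightarrow> l"
    using far_secants_subsequence[OF X g, of "\<lambda>i. H (s i)" "\<lambda>i. inverse (real (Suc (s i)))"
        "Z \<circ> s" z "P \<circ> s" r] H(1) e s(2) z P(1) by auto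
  have "open (\<Union>\<V>)"
    using \<V>(4) by blast
  then have "l \<notin> \<Union>\<V>"
    using t(3) P(2) closed_sequentially[of "- \<Union>\<V>" "P \<circ> s \<circ> t" l] by (auto simp: closed_Compl)
  then show False
    using t(2) \<V>(3) by blast
qed

end

subsection \<open>General position\<close>

text \<open>As \<open>p\<close> need not be injective, the weights are collected over each fibre of
  \<open>p\<close>.\<close>

lemma sum_in_affine_hull_image:
  fixes p :: "'i \<Rightarrow> 'b::real_vector"
  assumes "finite S" "sum u S = 1"
  shows "(\<Sum>i\<in>S. u i *\<^sub>R p i) \<in> affine hull (p ` S)"
proof -
  define w where "w y = sum u {i \<in> S. p i = y}" for y
  have "sum w (p ` S) = 1"
    using assms sum.image_gen[of S u p] by (simp add: w_def)
  moreover have "(\<Sum>y\<in>p ` S. w y *\<^sub>R y) = (\<Sum>i\<in>S. u i *\<^sub>R p i)"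
    unfolding sum.image_gen[OF assms(1), of "\<lambda>i. u i *\<^sub>R p i" p]
    by (intro sum.cong refl) (simp add: w_def scaleR_left.sum)
  ultimately show ?thesis
    using assms(1) by (auto simp: affine_hull_finite)
qed

lemma negligible_affine_hull_card:
  fixes T :: "'b::euclidean_space set"
  assumes "finite T" "card T \<le> DIM('b)"
  shows "negligible (affine hull T)"
proof -
  have "aff_dim (affine hull T) < int (DIM('b))"
    using aff_dim_le_card[OF assms(1)] assms(2) by simp
  then have "interior (affine hull T) = {}"
    using aff_dim_nonempty_interior[of "affine hull T"] by auto
  then show ?thesis
    by (simp add: negligible_convex_interior affine_imp_convex)
qed

text \<open>Affine independence of any at most \<open>DIM('b) + 1\<close> of the points. Stating it
  for coefficients on indices suits barycentric coordinates and rules out repeated points.\<close>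

definition general_position :: "'i set \<Rightarrow> ('i \<Rightarrow> 'b::euclidean_space) \<Rightarrow> bool" where
  "general_position I p \<longleftrightarrow>
     (\<forall>a. card {i \<in> I. a i \<noteq> 0} \<le> DIM('b) + 1 \<and> sum a I = 0 \<and> (\<Sum>i\<in>I. a i *\<^sub>R p i) = 0 \<longrightarrow>
        (\<forall>i\<in>I. a i = 0))"

text \<open>Points are placed one at a time, each off the hulls of at most \<open>DIM('b)\<close>
  earlier points; these are finitely many null sets and cannot fill a ball.\<close>

lemma general_position_approximation:
  fixes c :: "'i \<Rightarrow> 'b::euclidean_space"
  assumes "finite I" "e > 0"
  shows "\<exists>p. general_position I p \<and> (\<forall>i\<in>I. dist (p i) (c i) < e)"
  using assms(1)
proof induction
  case empty
  then show ?case
    by (simp add: general_position_def)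
next
  case (insert j I)
  then obtain p where p: "general_position I p" "\<And>i. i \<in> I \<Longrightarrow> dist (p i) (c i) < e"
    by blast
  define \<S> where "\<S> = {S. S \<subseteq> I \<and> card S \<le> DIM('b)}"
  have fin: "finite S" if "S \<in> \<S>" for S
    using that \<open>finite I\<close> finite_subset by (auto simp: \<S>_def)
  have "negligible (\<Union>((\<lambda>S. affine hull (p ` S)) ` \<S>))"
  proof (rule negligible_Union)
    show "finite ((\<lambda>S. affine hull (p ` S)) ` \<S>)"
      using \<open>finite I\<close> by (simp add: \<S>_def)
    show "negligible T" if T: "T \<in> (\<lambda>S. affine hull (p ` S)) ` \<S>" for T
    proof -
      obtain S where S: "S \<in> \<S>" "T = affine hull (p ` S)"
        using T by blast
      have "card (p ` S) \<le> card S"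
        using fin[OF S(1)] by (rule card_image_le)
      then show ?thesis
        using S fin[OF S(1)] by (auto simp: \<S>_def intro!: negligible_affine_hull_card)
    qed
  qed
  then have "\<not> ball (c j) e \<subseteq> (\<Union>S\<in>\<S>. affine hull (p ` S))"
    using open_not_negligible[of "ball (c j) e"] \<open>e > 0\<close> negligible_subset by auto
  then obtain q where "q \<in> ball (c j) e" "q \<notin> (\<Union>S\<in>\<S>. affine hull (p ` S))"
    by blast
  then have q: "dist q (c j) < e" "\<And>S. S \<in> \<S> \<Longrightarrow> q \<notin> affine hull (p ` S)"
    by (auto simp: dist_commute)
  define p' where "p' = p(j := q)"
  have pI: "p' i = p i" if "i \<in> I" for i
    using that \<open>j \<notin> I\<close> by (auto simp: p'_def)
  have "general_position (insert j I) p'"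
    unfolding general_position_def
  proof (intro allI impI, elim conjE)
    fix a assume card: "card {i \<in> insert j I. a i \<noteq> 0} \<le> DIM('b) + 1"
      and sum: "sum a (insert j I) = 0" "(\<Sum>i\<in>insert j I. a i *\<^sub>R p' i) = 0"
    have sumI: "a j + sum a I = 0" "a j *\<^sub>R q + (\<Sum>i\<in>I. a i *\<^sub>R p i) = 0"
    proof -
      have "(\<Sum>i\<in>I. a i *\<^sub>R p' i) = (\<Sum>i\<in>I. a i *\<^sub>R p i)"
        by (intro sum.cong refl) (simp add: pI)
      then show "a j + sum a I = 0" "a j *\<^sub>R q + (\<Sum>i\<in>I. a i *\<^sub>R p i) = 0"
        using sum insert.hyps by (simp_all add: p'_def)
    qed
    \<comment> \<open>Otherwise \<open>q\<close> would be an affine combination of at most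
      \<open>DIM('b)\<close> earlier points, \<open>j\<close> itself taking up one of the
      \<open>DIM('b) + 1\<close> allowed indices.\<close>
    have "a j = 0"
    proof (rule ccontr)
      assume aj: "a j \<noteq> 0"
      define S where "S = {i \<in> I. a i \<noteq> 0}"
      have S: "finite S" "S \<subseteq> I" "j \<notin> S"
        using insert.hyps by (auto simp: S_def)
      have "{i \<in> insert j I. a i \<noteq> 0} = insert j S"
        using aj by (auto simp: S_def)
      then have "S \<in> \<S>"
        using card S by (simp add: \<S>_def)
      have "sum a I = sum a S" "(\<Sum>i\<in>I. a i *\<^sub>R p i) = (\<Sum>i\<in>S. a i *\<^sub>R p i)"
        using insert.hyps(1) by (auto simp: S_def intro!: sum.mono_neutral_right)
      then have 1: "sum a S = - a j" and 2: "(\<Sum>i\<in>S. a i *\<^sub>R p i) = - (a j *\<^sub>R q)"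
        using sumI by (simp_all add: eq_neg_iff_add_eq_0 add.commute)
      have "(\<Sum>i\<in>S. (- a i / a j) *\<^sub>R p i) = (- 1 / a j) *\<^sub>R (\<Sum>i\<in>S. a i *\<^sub>R p i)"
        by (simp add: scaleR_sum_right)
      also have "\<dots> = q"
        using aj by (simp add: 2)
      finally have "q = (\<Sum>i\<in>S. (- a i / a j) *\<^sub>R p i)" ..
      moreover have "(\<Sum>i\<in>S. - a i / a j) = - (sum a S) / a j"
        by (simp add: sum_divide_distrib sum_negf)
      then have "(\<Sum>i\<in>S. - a i / a j) = 1"
        using aj by (simp add: 1)
      ultimately have "q \<in> affine hull (p ` S)"
        using sum_in_affine_hull_image[OF S(1), of "\<lambda>i. - a i / a j" p] by simp
      then show False
        using q(2) \<open>S \<in> \<S>\<close> by blast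
    qed
    then have "{i \<in> insert j I. a i \<noteq> 0} = {i \<in> I. a i \<noteq> 0}"
      by auto
    then have "card {i \<in> I. a i \<noteq> 0} \<le> DIM('b) + 1"
      using card by (simp only:)
    moreover have "sum a I = 0" "(\<Sum>i\<in>I. a i *\<^sub>R p i) = 0"
      using sumI \<open>a j = 0\<close> by simp_all
    ultimately have "\<forall>i\<in>I. a i = 0"
      using p(1) unfolding general_position_def by blast
    then show "\<forall>i\<in>insert j I. a i = 0"
      using \<open>a j = 0\<close> by simp
  qed
  moreover have "\<forall>i\<in>insert j I. dist (p' i) (c i) < e"
    using p(2) q(1) pI by (auto simp: p'_def)
  ultimately show ?case
    by blast
qed

text \<open>
  \<open>u, u'\<close> and \<open>v, v'\<close> are barycentric coordinates on two simplices without common vertex; the proof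
  compares two affine expressions of \<open>z\<close> in the affinely independent vertices of their join.
\<close>

lemma secant_through_point_unique:
  fixes I S T :: "'i set" and p :: "'i \<Rightarrow> real ^ 'm" and u v u' v' :: "'i \<Rightarrow> real"
  defines "P \<equiv> \<lambda>w. \<Sum>i\<in>I. w i *\<^sub>R p i"
  assumes I: "finite I" and gp: "general_position I p"
    and ST: "S \<subseteq> I" "T \<subseteq> I" "S \<inter> T = {}" "card S + card T \<le> CARD('m) + 1"
    and supp: "\<And>i. i \<in> I - S \<Longrightarrow> u i = 0" "\<And>i. i \<in> I - T \<Longrightarrow> v i = 0"
      "\<And>i. i \<in> I - S \<Longrightarrow> u' i = 0" "\<And>i. i \<in> I - T \<Longrightarrow> v' i = 0"
    and sums: "sum u I = 1" "sum v I = 1" "sum u' I = 1" "sum v' I = 1"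
    and ne: "P u \<noteq> z" "P v \<noteq> z" "P u' \<noteq> z" "P v' \<noteq> z"
    and eq: "direction (P u - z) = direction (P v - z)" "direction (P u' - z) = direction (P v' - z)"
  shows "P u = P u'"
proof -
  have gp': "a i = 0" if a: "\<And>i. i \<in> I - (S \<union> T) \<Longrightarrow> a i = 0" "sum a I = 0" "P a = 0" "i \<in> I" for a i
  proof -
    have "{i \<in> I. a i \<noteq> 0} \<subseteq> S \<union> T"
      using a(1) by auto
    moreover have "finite S" "finite T"
      using ST I finite_subset by blast+
    ultimately have "card {i \<in> I. a i \<noteq> 0} \<le> card S + card T"
      by (meson card_Un_le card_mono finite_UnI le_trans)
    then have "card {i \<in> I. a i \<noteq> 0} \<le> DIM(real ^ 'm) + 1"
      using ST(4) by simp
    then show ?thesis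
      using gp a(2,3,4) unfolding general_position_def P_def by blast
  qed
  obtain c where c: "P u - z = c *\<^sub>R (P v - z)"
    using eq(1) ne by (subst (asm) direction_eq_iff) auto
  obtain c' where c': "P u' - z = c' *\<^sub>R (P v' - z)"
    using eq(2) ne by (subst (asm) direction_eq_iff) auto
  have lin: "P (\<lambda>i. \<alpha> * w i + \<beta> * x i) = \<alpha> *\<^sub>R P w + \<beta> *\<^sub>R P x" for \<alpha> \<beta> w x
    by (simp add: P_def scaleR_add_left sum.distrib scaleR_sum_right)
  have lin': "(\<Sum>i\<in>I. \<alpha> * w i + \<beta> * x i) = \<alpha> * sum w I + \<beta> * sum x I"
    for \<alpha> \<beta> :: real and w x
    by (simp add: sum.distrib sum_distrib_left)
  \<comment> \<open>Collecting the multiples of \<open>z\<close> in the equation \<open>c\<close>: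
    \<open>b\<close> represents \<open>(1 - c) *\<^sub>R z\<close> and has total weight
    \<open>1 - c\<close>. The factor \<open>1\<close> fits the shape of \<open>lin\<close>.\<close>
  define b where "b i = 1 * u i + (- c) * v i" for i
  define b' where "b' i = 1 * u' i + (- c') * v' i" for i
  have b: "P b = (1 - c) *\<^sub>R z" "sum b I = 1 - c"
    using c unfolding b_def lin lin' by (simp_all add: sums algebra_simps)
  have b': "P b' = (1 - c') *\<^sub>R z" "sum b' I = 1 - c'"
    using c' unfolding b'_def lin lin' by (simp_all add: sums algebra_simps)
  \<comment> \<open>Scaling \<open>b\<close> and \<open>b'\<close> to the same multiple of
    \<open>z\<close> and subtracting leaves an affine dependence supported in
    \<open>S \<union> T\<close>, hence a trivial one.\<close>
  have bb: "(1 - c') * b i + (- (1 - c)) * b' i = 0" if "i \<in> I" for i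
  proof (rule gp'[OF _ _ _ that])
    show "(1 - c') * b i + (- (1 - c)) * b' i = 0" if "i \<in> I - (S \<union> T)" for i
      using that supp by (simp add: b_def b'_def)
  qed (simp_all only: lin lin' b b', simp_all add: algebra_simps)
  have lin0: "(1 - c') * b i = (1 - c) * b' i" if "i \<in> I" for i
    using bb[OF that] by (simp only: mult_minus_left add_eq_0_iff minus_minus)
  have vT: "i \<in> I" "v i = 0" "v' i = 0" if "i \<in> S" for i
    using that ST(1,3) supp(2,4)[of i] by auto
  have scaled: "(1 - c') * u i = (1 - c) * u' i" if "i \<in> S" for i
    using lin0[OF vT(1)[OF that]] vT(2,3)[OF that] by (simp add: b_def b'_def)
  have "sum u S = sum u I" "sum u' S = sum u' I"
    by (rule sum.mono_neutral_left[OF I ST(1)]; use supp(1,3) in blast)+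
  then have sumS: "sum u S = 1" "sum u' S = 1"
    by (simp_all only: sums)
  have "(1 - c') * sum u S = (1 - c) * sum u' S"
    using scaled by (simp add: sum_distrib_left)
  then have cc: "c' = c"
    using sumS by simp
  show ?thesis
  proof (cases "c = 1")
    \<comment> \<open>This case is void: \<open>b\<close> itself is now an affine dependence, so
      \<open>u\<close> vanishes on \<open>S\<close> although its weights there sum to 1.\<close>
    case True
    have "b i = 0" if "i \<in> I" for i
      by (rule gp'[OF _ _ _ that]) (use supp True b in \<open>simp_all add: b_def[abs_def]\<close>)
    then have "u i = 0" if "i \<in> S" for i
      using vT[OF that] by (simp add: b_def)
    then show ?thesis
      using sumS by simp
  next
    case False
    then have "u i = u' i" if "i \<in> I" for i
      using scaled[of i] cc supp(1,3)[of i] that by (cases "i \<in> S") auto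
    then show ?thesis
      by (simp add: P_def)
  qed
qed

section \<open>Partitions of unity and maps through the nerve of a cover\<close>

context Metric_space
begin

text \<open>The distance to the complement of \<open>V\<close> works, being positive on
  \<open>V\<close> by openness. When \<open>V = M\<close> there is no complement and a constant
  replaces it.\<close>

lemma open_support_function:
  assumes "openin mtopology V"
  obtains f where "continuous_map mtopology euclideanreal f" "\<And>x. x \<in> V \<Longrightarrow> f x > 0"
    "\<And>x. x \<in> M - V \<Longrightarrow> f x = 0"
proof (cases "V = M")
  case True
  then show thesis
    by (intro that[of "\<lambda>_. 1"]) auto
next
  case False
  define F where "F = M - V"
  have F: "F \<noteq> {}" "F \<subseteq> M"
    using False openin_subset[OF assms] by (auto simp: F_def)
  define f where "f x = (INF y\<in>F. d x y)" for x
  have bdd: "bdd_below (d x ` F)" for x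
    by (meson bdd_belowI2 nonneg)
  have le: "f x \<le> d x y + f y" if "x \<in> M" "y \<in> M" for x y
  proof -
    have "f x - d x y \<le> f y"
      unfolding f_def[of y]
    proof (rule cINF_greatest[OF F(1)])
      fix w assume w: "w \<in> F"
      have "f x \<le> d x w"
        unfolding f_def by (rule cINF_lower[OF bdd w])
      also have "\<dots> \<le> d x y + d y w"
        using that w F(2) by (intro triangle) auto
      finally show "f x - d x y \<le> d y w" by simp
    qed
    then show ?thesis by simp
  qed
  show thesis
  proof (rule that[of f])
    have "Lipschitz_continuous_map Self euclidean_metric f"
      unfolding Lipschitz_continuous_map_def
    proof (intro conjI exI[of _ 1] ballI)
      show "mdist euclidean_metric (f x) (f y) \<le> 1 * mdist Self x y"
        if "x \<in> mspace Self" "y \<in> mspace Self" for x y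
        using le[of x y] le[of y x] that commute[of x y] by (simp add: dist_real_def)
    qed auto
    then show "continuous_map mtopology euclideanreal f"
      using Lipschitz_continuous_imp_continuous_map[of Self euclidean_metric f]
      by (simp add: mtopology_of_def)
  next
    fix x assume x: "x \<in> V"
    then obtain r where r: "r > 0" "mball x r \<subseteq> V"
      using assms unfolding openin_mtopology by blast
    have xM: "x \<in> M"
      using openin_subset[OF assms] x by auto
    have "r \<le> f x"
      unfolding f_def
    proof (rule cINF_greatest[OF F(1)])
      fix y assume "y \<in> F"
      then have "y \<in> M" "y \<notin> mball x r"
        using r(2) by (auto simp: F_def)
      then show "r \<le> d x y"
        using xM by simp
    qed
    then show "0 < f x"
      using r(1) by simp
  next
    fix x assume x: "x \<in> M - V"
    then have "f x \<le> d x x"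
      unfolding f_def by (intro cINF_lower[OF bdd]) (simp add: F_def)
    moreover have "0 \<le> f x"
      unfolding f_def by (intro cINF_greatest[OF F(1)]) simp
    ultimately show "f x = 0"
      using x by simp
  qed
qed

text \<open>The functions from \<open>open_support_function\<close> are divided by their sum, which
  is positive because the sets cover.\<close>

lemma partition_of_unity_open_supports:
  assumes fin: "finite \<V>" and cover: "open_cover_of mtopology \<V>"
  obtains \<phi> :: "'a set \<Rightarrow> 'a \<Rightarrow> real"
  where "\<And>V. V \<in> \<V> \<Longrightarrow> continuous_map mtopology euclideanreal (\<phi> V)"
    "\<And>V x. V \<in> \<V> \<Longrightarrow> x \<in> M \<Longrightarrow> 0 \<le> \<phi> V x"
    "\<And>V x. V \<in> \<V> \<Longrightarrow> x \<in> M - V \<Longrightarrow> \<phi> V x = 0"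
    "\<And>x. x \<in> M \<Longrightarrow> (\<Sum>V\<in>\<V>. \<phi> V x) = 1"
proof -
  have "\<forall>V\<in>\<V>. \<exists>f. continuous_map mtopology euclideanreal f \<and> (\<forall>x\<in>V. f x > 0) \<and> (\<forall>x\<in>M - V. f x = 0)"
    using cover unfolding open_cover_of_def by (metis open_support_function)
  then obtain f where f: "\<And>V. V \<in> \<V> \<Longrightarrow> continuous_map mtopology euclideanreal (f V)"
    "\<And>V x. V \<in> \<V> \<Longrightarrow> x \<in> V \<Longrightarrow> f V x > 0" "\<And>V x. V \<in> \<V> \<Longrightarrow> x \<in> M - V \<Longrightarrow> f V x = 0"
    by metis
  define s where "s x = (\<Sum>V\<in>\<V>. f V x)" for x
  have f0: "0 \<le> f V x" if "V \<in> \<V>" "x \<in> M" for V x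
    using f(2,3)[OF that(1), of x] that(2) by (cases "x \<in> V") auto
  have s: "s x > 0" if "x \<in> M" for x
  proof -
    obtain V where "V \<in> \<V>" "x \<in> V"
      using cover \<open>x \<in> M\<close> by (auto simp: open_cover_of_def)
    then show ?thesis
      unfolding s_def using f0 f(2) that by (intro sum_pos2[OF fin, of V]) auto
  qed
  show thesis
  proof (rule that[of "\<lambda>V x. f V x / s x"])
    show "continuous_map mtopology euclideanreal (\<lambda>x. f V x / s x)" if "V \<in> \<V>" for V
    proof (rule continuous_map_real_divide)
      show "continuous_map mtopology euclideanreal s"
        unfolding s_def using fin f(1) by (intro continuous_map_sum)
      show "s x \<noteq> 0" if "x \<in> topspace mtopology" for x
        using s[of x] that by auto
    qed (use f(1) that in auto)
    show "(\<Sum>V\<in>\<V>. f V x / s x) = 1" if "x \<in> M" for x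
      using s[OF that] by (simp add: sum_divide_distrib[symmetric] s_def)
    show "0 \<le> f V x / s x" if "V \<in> \<V>" "x \<in> M" for V x
      using f0[OF that] s[OF that(2)] by simp
  qed (simp add: f(3))
qed

lemma small_oscillation_cover:
  assumes X: "compact_space mtopology" and g: "continuous_map mtopology euclidean (g :: 'a \<Rightarrow> 'b::metric_space)"
    and "e > 0" "r > 0"
  obtains \<U> where "finite \<U>" "open_cover_of mtopology \<U>"
    "\<And>U x y. U \<in> \<U> \<Longrightarrow> x \<in> U \<Longrightarrow> y \<in> U \<Longrightarrow> d x y < r \<and> dist (g x) (g y) < e"
proof -
  define N where "N x = mball x (r/2) \<inter> {y \<in> M. g y \<in> ball (g x) (e/2)}" for x
  have "openin mtopology (N x)" for x
    unfolding N_def using openin_continuous_map_preimage[OF g, of "ball (g x) (e/2)"]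
    by (intro openin_Int) auto
  moreover have "x \<in> N x" if "x \<in> M" for x
    using that \<open>e > 0\<close> \<open>r > 0\<close> by (simp add: N_def)
  then have "M \<subseteq> \<Union>(N ` M)"
    by blast
  ultimately have "\<exists>\<F>. finite \<F> \<and> \<F> \<subseteq> N ` M \<and> M \<subseteq> \<Union>\<F>"
    using X[unfolded compact_space_alt, rule_format, of "N ` M"] by auto
  then obtain \<F> where \<F>: "finite \<F>" "\<F> \<subseteq> N ` M" "M \<subseteq> \<Union>\<F>"
    by blast
  show thesis
  proof (rule that[OF \<F>(1)])
    have "openin mtopology U" if "U \<in> \<F>" for U
      using that \<F>(2) \<open>\<And>x. openin mtopology (N x)\<close> by blast
    then show "open_cover_of mtopology \<F>"
      using \<F>(3) openin_subset[of mtopology] unfolding open_cover_of_def topspace_mtopology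
      by (auto intro!: subset_antisym)
    fix U x y assume "U \<in> \<F>" "x \<in> U" "y \<in> U"
    then obtain a where "x \<in> N a" "y \<in> N a" "a \<in> M"
      using \<F>(2) by blast
    then have "x \<in> M" "y \<in> M" "a \<in> M" "d a x < r/2" "d a y < r/2"
      "dist (g a) (g x) < e/2" "dist (g a) (g y) < e/2"
      by (auto simp: N_def)
    then show "d x y < r \<and> dist (g x) (g y) < e"
      using triangle[of x a y] dist_triangle3[of "g x" "g y" "g a"] commute[of x a] by auto
  qed
qed

text \<open>The direction of a far secant depends only on the two sets of cover members containing
  its witnesses, and there are finitely many such pairs of sets.\<close>

lemma finite_far_secants_approximation:
  fixes g :: "'a \<Rightarrow> real ^ 'm"
  assumes X: "compact_space mtopology" and dim: "covering_dim_le mtopology n"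
    and m: "CARD('m) \<ge> 2 * n + 1"
    and g: "continuous_map mtopology euclidean g" and "e > 0" "r > 0"
  obtains h where "continuous_map mtopology euclidean h" "\<And>x. x \<in> M \<Longrightarrow> dist (g x) (h x) \<le> e"
    "\<And>z. z \<notin> h ` M \<Longrightarrow> finite (far_secants M d r h z)"
proof -
  have e2: "e/2 > 0"
    using \<open>e > 0\<close> by simp
  obtain \<U> where \<U>: "finite \<U>" "open_cover_of mtopology \<U>"
    "\<And>U x y. U \<in> \<U> \<Longrightarrow> x \<in> U \<Longrightarrow> y \<in> U \<Longrightarrow> d x y < r \<and> dist (g x) (g y) < e/2"
    using small_oscillation_cover[OF X g e2 \<open>r > 0\<close>] by metis
  obtain \<V> where \<V>: "finite \<V>" "open_cover_of mtopology \<V>" "refines \<V> \<U>"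
    "\<And>x. x \<in> M \<Longrightarrow> card {V \<in> \<V>. x \<in> V} \<le> n + 1"
    using dim \<U>(1,2) unfolding covering_dim_le_def topspace_mtopology by meson
  have small: "d x y < r \<and> dist (g x) (g y) < e/2" if "V \<in> \<V>" "x \<in> V" "y \<in> V" for V x y
  proof -
    obtain U where "U \<in> \<U>" "V \<subseteq> U"
      using \<V>(3) \<open>V \<in> \<V>\<close> unfolding refines_def by blast
    then show ?thesis
      using \<U>(3) \<open>x \<in> V\<close> \<open>y \<in> V\<close> by blast
  qed
  obtain \<phi> where \<phi>: "\<And>V. V \<in> \<V> \<Longrightarrow> continuous_map mtopology euclideanreal (\<phi> V)"
    "\<And>V x. V \<in> \<V> \<Longrightarrow> x \<in> M \<Longrightarrow> 0 \<le> \<phi> V x"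
    "\<And>V x. V \<in> \<V> \<Longrightarrow> x \<in> M - V \<Longrightarrow> \<phi> V x = 0"
    "\<And>x. x \<in> M \<Longrightarrow> (\<Sum>V\<in>\<V>. \<phi> V x) = 1"
    by (rule partition_of_unity_open_supports[OF \<V>(1,2)], rule that)
  \<comment> \<open>The vertex for \<open>V\<close> is placed near the value of \<open>g\<close> at
    some point of \<open>V\<close>. For empty \<open>V\<close> that point is arbitrary, which is
    harmless since \<open>\<phi> V\<close> then vanishes on \<open>M\<close>.\<close>
  obtain p where p: "general_position \<V> p" "\<And>V. V \<in> \<V> \<Longrightarrow> dist (p V) (g (SOME x. x \<in> V)) < e/2"
    using general_position_approximation[OF \<V>(1) e2, of "\<lambda>V. g (SOME x. x \<in> V)"] by blast
  define h where "h x = (\<Sum>V\<in>\<V>. \<phi> V x *\<^sub>R p V)" for x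
  show thesis
  proof (rule that[of h])
    show "continuous_map mtopology euclidean h"
      unfolding h_def using \<V>(1) \<phi>(1)
      by (simp add: continuous_map_atin tendsto_scaleR tendsto_sum)
  next
    fix x assume x: "x \<in> M"
    have close: "norm (p V - g x) \<le> e" if V: "V \<in> \<V>" "x \<in> V" for V
    proof -
      have "(SOME x. x \<in> V) \<in> V"
        using V(2) by (rule someI)
      then have "dist (g (SOME x. x \<in> V)) (g x) < e/2"
        using small[OF V(1) _ V(2)] by blast
      then show ?thesis
        using p(2)[OF V(1)] dist_triangle[of "p V" "g x" "g (SOME x. x \<in> V)"] by (simp add: dist_norm)
    qed
    have "h x - g x = (\<Sum>V\<in>\<V>. \<phi> V x *\<^sub>R p V) - (\<Sum>V\<in>\<V>. \<phi> V x) *\<^sub>R g x"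
      by (simp add: h_def \<phi>(4)[OF x])
    also have "\<dots> = (\<Sum>V\<in>\<V>. \<phi> V x *\<^sub>R (p V - g x))"
      by (simp add: scaleR_sum_left scaleR_diff_right sum_subtractf)
    finally have "norm (h x - g x) \<le> (\<Sum>V\<in>\<V>. norm (\<phi> V x *\<^sub>R (p V - g x)))"
      using norm_sum by metis
    also have "\<dots> \<le> (\<Sum>V\<in>\<V>. \<phi> V x * e)"
    proof (rule sum_mono)
      fix V assume V: "V \<in> \<V>"
      show "norm (\<phi> V x *\<^sub>R (p V - g x)) \<le> \<phi> V x * e"
      proof (cases "x \<in> V")
        case True
        then show ?thesis
          using close[OF V] \<phi>(2)[OF V x] by (simp add: mult_left_mono)
      next
        case False
        then show ?thesis
          using \<phi>(3)[OF V] x by simp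
      qed
    qed
    also have "\<dots> = e"
      by (simp add: sum_distrib_right[symmetric] \<phi>(4)[OF x])
    finally show "dist (g x) (h x) \<le> e"
      by (simp add: dist_norm norm_minus_commute)
  next
    fix z assume z: "z \<notin> h ` M"
    define R where "R = {(x, y). x \<in> M \<and> y \<in> M \<and> r \<le> d x y \<and> direction (h x - z) = direction (h y - z)}"
    \<comment> \<open>\<open>S x\<close> is the vertex set of a simplex of the nerve that carries
      \<open>x\<close>.\<close>
    define S where "S x = {V \<in> \<V>. x \<in> V}" for x
    have unique: "h x = h x'"
      if xy: "(x, y) \<in> R" "(x', y') \<in> R" and eq: "S x = S x'" "S y = S y'" for x y x' y'
    proof -
      have M: "x \<in> M" "y \<in> M" "x' \<in> M" "y' \<in> M" and "r \<le> d x y"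
        using xy by (auto simp: R_def)
      \<comment> \<open>A common member would force \<open>d x y < r\<close>.\<close>
      have "S x \<inter> S y = {}"
        using small[of _ x y] \<open>r \<le> d x y\<close> by (fastforce simp: S_def)
      \<comment> \<open>The dimension hypothesis enters here: \<open>2 * (n + 1)\<close> vertices
        are at most \<open>CARD('m) + 1\<close>.\<close>
      moreover have "card (S x) + card (S y) \<le> CARD('m) + 1"
        using \<V>(4)[OF M(1)] \<V>(4)[OF M(2)] m by (simp add: S_def)
      moreover have "\<phi> V w = 0" if "w \<in> M" "V \<in> \<V> - S w" for w V
        using \<phi>(3)[of V w] that by (auto simp: S_def)
      moreover have "h w \<noteq> z" if "w \<in> M" for w
        using z that by auto
      ultimately show ?thesis
        unfolding h_def using \<V>(1) p(1) M xy eq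
        by (intro secant_through_point_unique[where S="S x" and T="S y" and z=z
              and v="\<lambda>V. \<phi> V y" and v'="\<lambda>V. \<phi> V y'"])
          (auto simp: R_def h_def \<phi>(4) S_def)
    qed
    \<comment> \<open>A representative pair is chosen for each pair of vertex sets; by
      \<open>unique\<close> the direction does not depend on it.\<close>
    define D where "D A = direction (h (fst (SOME w. w \<in> R \<and> (S (fst w), S (snd w)) = A)) - z)" for A
    have "far_secants M d r h z \<subseteq> D ` (Pow \<V> \<times> Pow \<V>)"
    proof
      fix P assume "P \<in> far_secants M d r h z"
      then obtain x y where xy: "(x, y) \<in> R" "P = direction (h x - z)"
        unfolding far_secants_def R_def by blast
      define w where "w = (SOME w. w \<in> R \<and> (S (fst w), S (snd w)) = (S x, S y))"
      have "w \<in> R \<and> (S (fst w), S (snd w)) = (S x, S y)"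
        unfolding w_def by (rule someI[of _ "(x, y)"]) (use xy in simp)
      then have "h (fst w) = h x"
        using unique[of "fst w" "snd w" x y] xy(1) by simp
      then have "P = D (S x, S y)"
        using xy(2) by (simp add: D_def w_def)
      moreover have "(S x, S y) \<in> Pow \<V> \<times> Pow \<V>"
        by (auto simp: S_def)
      ultimately show "P \<in> D ` (Pow \<V> \<times> Pow \<V>)"
        by blast
    qed
    then show "finite (far_secants M d r h z)"
      using \<V>(1) by (meson finite_Pow_iff finite_SigmaI finite_imageI finite_subset)
  qed
qed

end

section \<open>The set of maps as a countable intersection of dense open sets\<close>

theorem theorem1p1:
  fixes X :: "'a topology" and n :: nat
  assumes "compact_space X"
    and "metrizable_space X"
    and "covering_dim_le X n"
    and "CARD('m::finite) \<ge> 2 * n + 1"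
  shows "let C = mtopology_of (map_space X :: ('a \<Rightarrow> real ^ 'm) metric);
             G = {g \<in> topspace C. \<forall>z. z \<notin> g ` topspace X \<longrightarrow>
                    covering_dim_le (subtopology (plane_space 1) (plane_preimages X 2 1 g z)) 0}
         in gdelta_in C G \<and> C closure_of G = topspace C"
proof -
  obtain M d where "Metric_space M d" and X: "X = Metric_space.mtopology M d"
    using assms(2) unfolding metrizable_space_def by blast
  interpret Metric_space M d by fact
  have cpt: "compact_space mtopology" and dim: "covering_dim_le mtopology n"
    using assms(1,3) by (simp_all add: X)
  define m :: "('a \<Rightarrow> real ^ 'm) metric" where "m = map_space mtopology"
  interpret F: Metric_space "mspace m" "mdist m"
    by simp
  have Ctop: "mtopology_of m = F.mtopology"
    by (simp add: mtopology_of_def)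
  have mspace: "f \<in> mspace m \<longleftrightarrow> f \<in> extensional M \<and> continuous_map mtopology euclidean f" for f
    using mspace_map_space_compact[OF cpt] by (auto simp: m_def)
  define sep where "sep r h z \<longleftrightarrow> fine_separated r (far_secants M d r h z)"
    for r and h :: "'a \<Rightarrow> real ^ 'm" and z
  \<comment> \<open>A single parameter \<open>r\<close> governs the mesh, the distance of the
    witnesses, and the region of admissible \<open>z\<close>; as \<open>r\<close> tends to 0 the
    regions exhaust the complement of the image.\<close>
  define W where "W r = {h \<in> mspace m. \<forall>z. norm z \<le> 1/r \<longrightarrow> (\<forall>x\<in>M. r \<le> dist z (h x)) \<longrightarrow> sep r h z}" for r
  \<comment> \<open>Taking interiors makes the sets open at once; that they still contain
    \<open>G\<close> is what stability provides.\<close>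
  define V where "V i = F.mtopology interior_of W (inverse (real (Suc i)))" for i
  define G where "G = {g \<in> mspace m. \<forall>z. z \<notin> g ` M \<longrightarrow>
    covering_dim_le (subtopology (plane_space 1) (plane_preimages mtopology 2 1 g z)) 0}"
  have dim0_iff: "covering_dim_le (subtopology (plane_space 1) (plane_preimages mtopology 2 1 g z)) 0 \<longleftrightarrow>
      covering_dim_le (top_of_set (secant_directions mtopology g z)) 0"
    if "z \<notin> g ` M" for g :: "'a \<Rightarrow> real ^ 'm" and z
  proof -
    have hom: "homeomorphic_map (subtopology (plane_space 1) (plane_preimages mtopology 2 1 g z))
        (top_of_set (secant_directions mtopology g z)) line_direction"
      using that by (intro homeomorphic_map_plane_preimages) simp
    then obtain k where "homeomorphic_maps (subtopology (plane_space 1) (plane_preimages mtopology 2 1 g z))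
        (top_of_set (secant_directions mtopology g z)) line_direction k"
      using homeomorphic_map_maps by blast
    then have hom': "homeomorphic_map (top_of_set (secant_directions mtopology g z))
        (subtopology (plane_space 1) (plane_preimages mtopology 2 1 g z)) k"
      using homeomorphic_maps_map by blast
    show ?thesis
      using covering_dim_le_0_homeomorphic[OF hom] covering_dim_le_0_homeomorphic[OF hom'] by (rule iffI)
  qed
  \<comment> \<open>Stability read in the supremum metric. It is applied to the maps in
    \<open>G\<close> and to the approximants with finitely many far secants.\<close>
  have interior: "g \<in> F.mtopology interior_of W r"
    if g: "g \<in> mspace m" and r: "r > 0" and sep: "\<And>z. z \<notin> g ` M \<Longrightarrow> sep r g z" for g r
  proof -
    have "continuous_map mtopology euclidean g"
      using g mspace by blast
    then obtain \<delta> where \<delta>: "\<delta> > 0"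
      "\<And>h z. \<lbrakk>\<And>x. x \<in> M \<Longrightarrow> dist (g x) (h x) \<le> \<delta>; norm z \<le> 1/r; \<And>x. x \<in> M \<Longrightarrow> r \<le> dist z (h x)\<rbrakk>
       \<Longrightarrow> fine_separated r (far_secants M d r h z)"
      using fine_separated_far_secants_stable[OF cpt _ r sep[unfolded sep_def]] by metis
    have "F.mball g \<delta> \<subseteq> W r"
    proof
      fix h assume "h \<in> F.mball g \<delta>"
      then have h: "h \<in> mspace m" "mdist m g h \<le> \<delta>"
        by auto
      have "dist (g x) (h x) \<le> \<delta>" if "x \<in> M" for x
        using mdist_cfunspace_imp_mdist_le[of g mtopology euclidean_metric h \<delta> x] g h that
        by (simp add: m_def)
      then show "h \<in> W r"
        using \<delta>(2)[of h] h(1) by (auto simp: W_def sep_def)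
    qed
    moreover have "g \<in> F.mball g \<delta>"
      using g \<delta>(1) by simp
    ultimately show ?thesis
      by (meson F.openin_mball interior_of_maximal subsetD)
  qed
  have G_eq: "G = \<Inter>(range V)"
  proof (intro subset_antisym subsetI)
    fix g assume g: "g \<in> G"
    have "g \<in> V i" for i
      unfolding V_def
    proof (rule interior)
      show "g \<in> mspace m"
        using g by (simp add: G_def)
      fix z assume z: "z \<notin> g ` M"
      have "covering_dim_le (top_of_set (secant_directions mtopology g z)) 0"
        using g z dim0_iff by (simp add: G_def)
      moreover have "compact (far_secants M d (inverse (real (Suc i))) g z)"
        using g z mspace by (intro compact_far_secants[OF cpt]) (auto simp: G_def)
      moreover have "far_secants M d (inverse (real (Suc i))) g z \<subseteq> secant_directions mtopology g z"
        unfolding secant_directions_eq_Union_far_secants by blast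
      ultimately show "sep (inverse (real (Suc i))) g z"
        unfolding sep_def by (intro covering_dim_le_0_imp_fine_separated) auto
    qed simp
    then show "g \<in> \<Inter>(range V)"
      by blast
  next
    fix g assume g: "g \<in> \<Inter>(range V)"
    have W: "g \<in> W (inverse (real (Suc i)))" for i
    proof -
      have "g \<in> V i"
        using g by blast
      then show ?thesis
        unfolding V_def by (rule subsetD[OF interior_of_subset])
    qed
    then have gm: "g \<in> mspace m"
      by (auto simp: W_def)
    then have cont: "continuous_map mtopology euclidean g"
      using mspace by blast
    have "covering_dim_le (top_of_set (secant_directions mtopology g z)) 0" if z: "z \<notin> g ` M" for z
      unfolding secant_directions_eq_Union_far_secants
    proof (rule covering_dim_le_0_Union_fine_separated)
      fix k
      show "compact (far_secants M d (inverse (real (Suc k))) g z)"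
        by (rule compact_far_secants[OF cpt cont z])
      fix \<epsilon> :: real assume "\<epsilon> > 0"
      have "compact (g ` M)"
        using image_compactin[OF _ cont] cpt by (simp add: compact_space_def)
      then obtain \<rho> where \<rho>: "\<rho> > 0" "\<And>x. x \<in> M \<Longrightarrow> \<rho> \<le> dist z (g x)"
        using separate_point_closed[of "g ` M" z] z compact_imp_closed by (metis imageI)
      \<comment> \<open>The four bounds give, in order, the mesh \<open>\<epsilon>\<close>, the
        distance of \<open>z\<close> from the image, the inclusion of the far secants at scale
        \<open>inverse (real (Suc k))\<close>, and \<open>norm z \<le> 1/r\<close>. The
        \<open>+ 1\<close> keeps the last bound positive when \<open>z = 0\<close>.\<close>
      define s where "s = Min {\<epsilon>, \<rho>, inverse (real (Suc k)), inverse (norm z + 1)}"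
      have "s > 0"
        using \<open>\<epsilon> > 0\<close> \<rho>(1) by (simp add: s_def add_nonneg_pos)
      then obtain i where i: "inverse (real (Suc i)) < s"
        using reals_Archimedean by blast
      define r where "r = inverse (real (Suc i))"
      have r: "0 < r" "r \<le> \<epsilon>" "r \<le> \<rho>" "r \<le> inverse (real (Suc k))" "r \<le> inverse (norm z + 1)"
        using i by (auto simp: r_def s_def)
      have "norm z + 1 \<le> 1/r"
        using le_imp_inverse_le[OF r(5,1)] by (simp add: inverse_eq_divide)
      moreover have "\<forall>x\<in>M. r \<le> dist z (g x)"
        using \<rho>(2) r(3) by force
      ultimately have "sep r g z"
        using W[of i] by (auto simp: W_def r_def)
      then show "fine_separated \<epsilon> (far_secants M d (inverse (real (Suc k))) g z)"
        unfolding sep_def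
        by (rule fine_separated_subset[OF _ far_secants_antimono[OF r(4)] r(2)])
    qed
    then show "g \<in> G"
      using gm dim0_iff by (simp add: G_def)
  qed
  \<comment> \<open>A map with finitely many far secants at scale \<open>r\<close> satisfies the
    separation condition for every \<open>z\<close> off its image, hence lies in \<open>V i\<close>
    by \<open>interior\<close>.\<close>
  have dense: "F.mtopology closure_of (V i) = mspace m" for i
  proof (intro subset_antisym subsetI)
    show "f \<in> mspace m" if "f \<in> F.mtopology closure_of (V i)" for f
      using that closure_of_subset_topspace by fastforce
  next
    fix g assume g: "g \<in> mspace m"
    define r where "r = inverse (real (Suc i))"
    have "r > 0"
      by (simp add: r_def)
    have "\<exists>h\<in>V i. h \<in> F.mball g e" if "e > 0" for e
    proof -
      have "continuous_map mtopology euclidean g"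
        using g mspace by blast
      then obtain h where h: "continuous_map mtopology euclidean h" "\<And>x. x \<in> M \<Longrightarrow> dist (g x) (h x) \<le> e/2"
        "\<And>z. z \<notin> h ` M \<Longrightarrow> finite (far_secants M d r h z)"
        using finite_far_secants_approximation[OF cpt dim assms(4) _ half_gt_zero[OF \<open>e > 0\<close>] \<open>r > 0\<close>]
        by metis
      \<comment> \<open>Elements of the function space are extensional, so \<open>h\<close> is cut
        down to \<open>M\<close>; its far secants do not change.\<close>
      define h' where "h' = restrict h M"
      have h': "h' \<in> mspace m"
        unfolding mspace using h(1) by (auto simp: h'_def intro: continuous_map_eq)
      have "sep r h' z" if "z \<notin> h' ` M" for z
      proof -
        have "z \<notin> h ` M"
          using that by (auto simp: h'_def)
        then have "finite (far_secants M d r h' z)"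
          using h(3) far_secants_cong[of M h' h d r z] by (simp add: h'_def)
        then show ?thesis
          unfolding sep_def using \<open>r > 0\<close> by (rule fine_separated_finite)
      qed
      then have "h' \<in> V i"
        unfolding V_def r_def[symmetric] using h' \<open>r > 0\<close> by (intro interior)
      moreover have "mdist m g h' \<le> e/2"
        unfolding m_def using h(2) \<open>e > 0\<close> by (intro mdist_cfunspace_le) (auto simp: h'_def)
      then have "h' \<in> F.mball g e"
        using g h' \<open>e > 0\<close> by simp
      ultimately show ?thesis
        by blast
    qed
    then show "g \<in> F.mtopology closure_of (V i)"
      using g by (simp add: F.metric_closure_of)
  qed
  have V_open: "openin F.mtopology (V i)" for i
    by (simp add: V_def)
  have "gdelta_in F.mtopology G"
    unfolding G_eq using V_open by (intro gdelta_in_Inter) (auto intro: open_imp_gdelta_in)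
  moreover have "F.mtopology closure_of G = mspace m"
    unfolding G_eq
  proof (rule F.metric_Baire_category)
    \<comment> \<open>Completeness is inherited from the target \<open>real ^ 'm\<close>.\<close>
    have "mcomplete_of m"
      unfolding m_def using Met_TC.mcomplete_cfunspace complete_UNIV by (simp add: euclidean_metric_def Met_TC.Self_def)
    then show "F.mcomplete"
      by (simp add: mcomplete_of_def)
  qed (use V_open dense in auto)
  ultimately show ?thesis
    unfolding Let_def X m_def[symmetric] Ctop F.topspace_mtopology topspace_mtopology G_def[symmetric]
    by (rule conjI)
qed

end
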